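(* For each simple reflection $s_i \in W$ define a divided difference operator $\delta_i$ acting as a $\mathbb{C}$-module homomorphism on classes $p \in H^*_T(G/P)$ by \[ \delta_i p = \frac{p-s_i \cdot p}{\alpha_i}.\] Then each $\delta_i$ is well-defined (that is, $\delta_i p \in H^*_T(G/P)$ for every $p \in H^*_T(G/P)$), and $\delta_i^2 = 0$. It satisfies the "Leibniz formula" \[ \delta_i (c\, p_{[v]}) = (\partial_i c)\, p_{[v]} + (s_i c)\, \delta_i p_{[v]}\] for every $c \in S(\mathfrak{t}^* )$ and every $[v] \in W/W_J$, where $\partial_i c = (c - s_i c)/\alpha_i$ is the Bernstein-Gelfand-Gelfand divided difference operator on $S(\mathfrak{t}^* )$. The action of $\delta_i$ on the basis of flow-up classes is given by \[ \delta_i p_{[v]} = \begin{cases} p_{[s_iv]} & \text{if } [s_iv]<_P[v], \\ 0 & \text{otherwise.}\end{cases}\]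
   Context: $G$ is a complex semisimple linear algebraic group, $T \subseteq B \subseteq P \subseteq G$ with $T$ a maximal torus, $B$ a Borel subgroup, $P$ a parabolic subgroup; $\mathfrak{t} = \mathrm{Lie}(T)$. $W=N(T)/T$ is the Weyl group, $\Delta$ the roots, $\Delta^+$ the positive roots (those of $B$), $\alpha_1,\dots,\alpha_n$ the simple roots, $s_1,\dots,s_n$ the simple reflections, $s_\alpha$ the reflection in $\alpha$, and $\ell$ the length. $J \subseteq \{1,\dots,n\}$ is the subset corresponding to $P$ (so $i\in J$ iff $\mathfrak{g}_{-\alpha_i} \subseteq \mathrm{Lie}(P)$), $W_J = \langle s_i : i \in J\rangle$, $[w]=wW_J \in W/W_J$, and $\le_P$ is the Bruhat order on $W/W_J$, i.e. the Bruhat order of $W$ on unique minimal-length coset representatives. $S(\mathfrak{t}^* )$ is the symmetric algebra over $\mathbb{C}$, on which $W$ acts by algebra automorphisms extending its action on $\mathfrak{t}^*$. Cohomology has complex coefficients, and $H^*_T(G/P)$ is given in its GKM presentation: it is the ring (coordinatewise operations) of functions $p : W/W_J \to S(\mathfrak{t}^* )$ such that $p([s_\alpha w]) - p([w]) \in (\alpha)$ for all $w \in W$ and $\alpha\in\Delta^+$ with $[s_\alpha w] \neq [w]$. The group $W$ acts on $H^*_T(G/P)$ by $(w \cdot p)([v]) = w\big(p([w^{-1}v])\big)$. Moment graph of $G/P$: vertices $W/W_J$; for $\alpha \in \Delta^+$ there is an edge labeled $\alpha$ between $[w]$ and $[s_\alpha w]$ whenever $[s_\alpha w]\neq [w]$,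 directed $[w] \mapsto [s_\alpha w]$ if $w^{-1}(\alpha)<0$ and $[s_\alpha w]\mapsto [w]$ otherwise. The flow-up (equivariant Schubert) class $p_{[w]} \in H^*_T(G/P)$ is the homogeneous class supported exactly on the $[v]$ with $[v] \ge_P [w]$ and with $p_{[w]}([w])$ equal to the product of the labels of all edges directed out of $[w]$. The classes $\{p_{[w]}\}$ exist and form an $S(\mathfrak{t}^* )$-module basis of $H^*_T(G/P)$. *)

theory Defs
  imports "HOL-Analysis.Analysis" "HOL-Library.Poly_Mapping"
begin

section \<open>Root data of a partial flag variety\<close>

text \<open>
  Both \<open>\<tt>\<^sup>*\<close> and \<open>\<tt>\<close> are coordinatised as \<^typ>\<open>complex^'n\<close>, in dual bases, so that their canonical
  pairing is the bilinear (not sesquilinear) form \<open>pairing\<close>.  The simple roots are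
  indexed by the same type \<open>'n\<close>: for a semisimple group they form a basis of \<open>\<tt>\<^sup>*\<close>.
\<close>

definition pairing :: "complex^'n \<Rightarrow> complex^'n \<Rightarrow> complex" where
  "pairing x h = (\<Sum>j\<in>UNIV. x $ j * h $ j)"

text \<open>
  The triple \<open>(G, B, P)\<close> (with \<open>T\<close>) enters through its roots, its simple roots, and the set \<open>J\<close>
  of those \<open>i\<close> for which the root space of \<open>-\<alpha>\<^sub>i\<close> lies in the Lie algebra of \<open>P\<close>.
\<close>

record ('n::finite) flag_datum =
  roots :: "(complex^'n) set"
  simple :: "'n \<Rightarrow> complex^'n"
  par :: "'n set"

definition reflection_along :: "complex^'n \<Rightarrow> complex^'n \<Rightarrow> complex^'n \<Rightarrow> complex^'n" where
  "reflection_along \<beta> h x = x - pairing x h *s \<beta>"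

definition is_coroot :: "(complex^'n) set \<Rightarrow> complex^'n \<Rightarrow> complex^'n \<Rightarrow> bool" where
  "is_coroot \<Phi> \<beta> h \<longleftrightarrow> pairing \<beta> h = 2 \<and> reflection_along \<beta> h ` \<Phi> \<subseteq> \<Phi>"

definition reduced_root_system :: "(complex^'n::finite) set \<Rightarrow> bool" where
  "reduced_root_system \<Phi> \<longleftrightarrow>
     finite \<Phi> \<and> 0 \<notin> \<Phi> \<and> vec.span \<Phi> = UNIV \<and>
     (\<forall>\<beta>\<in>\<Phi>. \<exists>h. is_coroot \<Phi> \<beta> h \<and> (\<forall>\<gamma>\<in>\<Phi>. pairing \<gamma> h \<in> \<int>)) \<and>
     (\<forall>\<beta>\<in>\<Phi>. \<forall>c. c *s \<beta> \<in> \<Phi> \<longrightarrow> c = 1 \<or> c = -1)"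

definition pos_roots :: "('n::finite) flag_datum \<Rightarrow> (complex^'n) set" where
  "pos_roots D =
     {\<beta> \<in> roots D. \<exists>k :: 'n \<Rightarrow> nat. \<beta> = (\<Sum>i\<in>UNIV. of_nat (k i) *s simple D i)}"

definition flag_datum :: "('n::finite) flag_datum \<Rightarrow> bool" where
  "flag_datum D \<longleftrightarrow>
     reduced_root_system (roots D) \<and>
     range (simple D) \<subseteq> roots D \<and>
     inj (simple D) \<and> vec.independent (range (simple D)) \<and>
     (\<forall>\<beta>\<in>roots D. \<beta> \<in> pos_roots D \<or> - \<beta> \<in> pos_roots D)"

text \<open>The coroot of a root is unique because the roots are finite in number and span.\<close>

definition coroot :: "('n::finite) flag_datum \<Rightarrow> complex^'n \<Rightarrow> complex^'n" where
  "coroot D \<beta> = (THE h. is_coroot (roots D) \<beta> h)"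

definition refl :: "('n::finite) flag_datum \<Rightarrow> complex^'n \<Rightarrow> complex^'n \<Rightarrow> complex^'n" where
  "refl D \<beta> = reflection_along \<beta> (coroot D \<beta>)"

abbreviation simple_refl :: "('n::finite) flag_datum \<Rightarrow> 'n \<Rightarrow> complex^'n \<Rightarrow> complex^'n" where
  "simple_refl D i \<equiv> refl D (simple D i)"


section \<open>Weyl group, length and Bruhat order\<close>

text \<open>
  The submonoid generated by \<open>S\<close>; as it is only used for sets of reflections, which are
  involutions, it is the generated subgroup.
\<close>

inductive_set generated :: "('a \<Rightarrow> 'a) set \<Rightarrow> ('a \<Rightarrow> 'a) set" for S where
  generated_id: "id \<in> generated S"
| generated_comp: "s \<in> S \<Longrightarrow> w \<in> generated S \<Longrightarrow> s \<circ> w \<in> generated S"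

definition weyl :: "('n::finite) flag_datum \<Rightarrow> (complex^'n \<Rightarrow> complex^'n) set" where
  "weyl D = generated (refl D ` roots D)"

definition weyl_par :: "('n::finite) flag_datum \<Rightarrow> (complex^'n \<Rightarrow> complex^'n) set" where
  "weyl_par D = generated (simple_refl D ` par D)"

definition len :: "('n::finite) flag_datum \<Rightarrow> (complex^'n \<Rightarrow> complex^'n) \<Rightarrow> nat" where
  "len D w =
     (LEAST k. \<exists>is. length is = k \<and> w = foldr (\<lambda>i u. simple_refl D i \<circ> u) is id)"

definition bruhat_step ::
    "('n::finite) flag_datum \<Rightarrow> (complex^'n \<Rightarrow> complex^'n) \<Rightarrow> (complex^'n \<Rightarrow> complex^'n) \<Rightarrow> bool" where
  "bruhat_step D u w \<longleftrightarrow>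
     u \<in> weyl D \<and> (\<exists>\<beta>\<in>pos_roots D. w = refl D \<beta> \<circ> u) \<and> len D u < len D w"

definition bruhat_le ::
    "('n::finite) flag_datum \<Rightarrow> (complex^'n \<Rightarrow> complex^'n) \<Rightarrow> (complex^'n \<Rightarrow> complex^'n) \<Rightarrow> bool" where
  "bruhat_le D = (bruhat_step D)\<^sup>*\<^sup>*"

type_synonym 'n coset = "(complex^'n \<Rightarrow> complex^'n) set"

definition coset :: "('n::finite) flag_datum \<Rightarrow> (complex^'n \<Rightarrow> complex^'n) \<Rightarrow> 'n coset" where
  "coset D w = (\<lambda>u. w \<circ> u) ` weyl_par D"

definition cosets :: "('n::finite) flag_datum \<Rightarrow> 'n coset set" where
  "cosets D = coset D ` weyl D"

definition min_rep :: "('n::finite) flag_datum \<Rightarrow> 'n coset \<Rightarrow> complex^'n \<Rightarrow> complex^'n" where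
  "min_rep D x = (THE w. w \<in> x \<and> (\<forall>u\<in>x. len D w \<le> len D u))"

definition le_P :: "('n::finite) flag_datum \<Rightarrow> 'n coset \<Rightarrow> 'n coset \<Rightarrow> bool" where
  "le_P D x y \<longleftrightarrow> bruhat_le D (min_rep D x) (min_rep D y)"

definition less_P :: "('n::finite) flag_datum \<Rightarrow> 'n coset \<Rightarrow> 'n coset \<Rightarrow> bool" where
  "less_P D x y \<longleftrightarrow> le_P D x y \<and> x \<noteq> y"


section \<open>The symmetric algebra\<close>

text \<open>
  The symmetric algebra of \<open>\<tt>\<^sup>*\<close> is the polynomial algebra over the complex numbers whose variables
  are the vectors of the coordinate basis; exponent vectors have type \<open>'n \<Rightarrow>\<^sub>0 nat\<close>.
\<close>

type_synonym 'n sym = "('n \<Rightarrow>\<^sub>0 nat) \<Rightarrow>\<^sub>0 complex"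

definition scal :: "complex \<Rightarrow> 'n sym" where
  "scal a = Poly_Mapping.single 0 a"

text \<open>The inclusion of \<open>\<tt>\<^sup>*\<close> as the linear polynomials.\<close>

definition lin :: "complex^'n \<Rightarrow> ('n::finite) sym" where
  "lin x = (\<Sum>j\<in>UNIV. Poly_Mapping.single (Poly_Mapping.single j 1) (x $ j))"

definition homogeneous :: "nat \<Rightarrow> ('n::finite) sym \<Rightarrow> bool" where
  "homogeneous d f \<longleftrightarrow>
     (\<forall>m\<in>Poly_Mapping.keys f. (\<Sum>j\<in>UNIV. Poly_Mapping.lookup m j) = d)"

text \<open>
  The algebra endomorphism extending a linear endomorphism \<open>w\<close> of \<open>\<tt>\<^sup>*\<close>: substitute
  \<open>w e\<^sub>j\<close> for the variable \<open>e\<^sub>j\<close>.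
\<close>

definition act :: "(complex^'n \<Rightarrow> complex^'n) \<Rightarrow> ('n::finite) sym \<Rightarrow> 'n sym" where
  "act w f =
     (\<Sum>m\<in>Poly_Mapping.keys f.
        scal (Poly_Mapping.lookup f m) * (\<Prod>j\<in>UNIV. lin (w (axis j 1)) ^ Poly_Mapping.lookup m j))"

text \<open>Only meaningful if \<open>g \<noteq> 0\<close> divides \<open>f\<close>.\<close>

definition exact_quot :: "('n::finite) sym \<Rightarrow> 'n sym \<Rightarrow> 'n sym" where
  "exact_quot f g = (THE q. f = g * q)"


section \<open>Equivariant cohomology in its GKM presentation\<close>

text \<open>
  Functions on the cosets are represented by total functions that vanish off \<open>cosets D\<close>, so
  that equality of classes is equality of functions.
\<close>

type_synonym 'n coh = "'n coset \<Rightarrow> 'n sym"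

definition HT :: "('n::finite) flag_datum \<Rightarrow> 'n coh set" where
  "HT D =
     {p. (\<forall>x. x \<notin> cosets D \<longrightarrow> p x = 0) \<and>
         (\<forall>w\<in>weyl D. \<forall>\<alpha>\<in>pos_roots D. coset D (refl D \<alpha> \<circ> w) \<noteq> coset D w \<longrightarrow>
            lin \<alpha> dvd p (coset D (refl D \<alpha> \<circ> w)) - p (coset D w))}"

definition weyl_act :: "(complex^'n \<Rightarrow> complex^'n) \<Rightarrow> ('n::finite) coh \<Rightarrow> 'n coh" where
  "weyl_act w p = (\<lambda>x. act w (p ((\<lambda>u. inv w \<circ> u) ` x)))"

text \<open>\<open>moment_edge D x \<alpha> y\<close>: there is an edge labelled \<open>\<alpha>\<close> directed from \<open>x\<close> to \<open>y\<close>.\<close>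

inductive moment_edge ::
    "('n::finite) flag_datum \<Rightarrow> 'n coset \<Rightarrow> complex^'n \<Rightarrow> 'n coset \<Rightarrow> bool" for D where
  edge_from: "w \<in> weyl D \<Longrightarrow> \<alpha> \<in> pos_roots D \<Longrightarrow> coset D (refl D \<alpha> \<circ> w) \<noteq> coset D w \<Longrightarrow>
    - inv w \<alpha> \<in> pos_roots D \<Longrightarrow> moment_edge D (coset D w) \<alpha> (coset D (refl D \<alpha> \<circ> w))"
| edge_to: "w \<in> weyl D \<Longrightarrow> \<alpha> \<in> pos_roots D \<Longrightarrow> coset D (refl D \<alpha> \<circ> w) \<noteq> coset D w \<Longrightarrow>
    - inv w \<alpha> \<notin> pos_roots D \<Longrightarrow> moment_edge D (coset D (refl D \<alpha> \<circ> w)) \<alpha> (coset D w)"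

definition is_flow_up :: "('n::finite) flag_datum \<Rightarrow> 'n coset \<Rightarrow> 'n coh \<Rightarrow> bool" where
  "is_flow_up D x p \<longleftrightarrow>
     p \<in> HT D \<and>
     (\<exists>d. \<forall>y\<in>cosets D. homogeneous d (p y)) \<and>
     (\<forall>y\<in>cosets D. p y \<noteq> 0 \<longleftrightarrow> le_P D x y) \<and>
     p x = (\<Prod>(\<alpha>, y)\<in>{(\<alpha>, y). moment_edge D x \<alpha> y}. lin \<alpha>)"

definition BGG :: "('n::finite) flag_datum \<Rightarrow> 'n \<Rightarrow> 'n sym \<Rightarrow> 'n sym" where
  "BGG D i c = exact_quot (c - act (simple_refl D i) c) (lin (simple D i))"

definition divdiff :: "('n::finite) flag_datum \<Rightarrow> 'n \<Rightarrow> 'n coh \<Rightarrow> 'n coh" where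
  "divdiff D i p =
     (\<lambda>x. exact_quot (p x - weyl_act (simple_refl D i) p x) (lin (simple D i)))"

end

theory Submission
  imports Defs
begin

text \<open>
  A class is a function on \<open>W/W\<^sub>J\<close> whose values differ by a multiple of \<open>\<beta>\<close> across every edge labelled \<open>\<beta>\<close>.
  The quotient \<open>(p(x) - s\<^sub>i p(s\<^sub>i x)) / \<alpha>\<^sub>i\<close> exists because \<open>p(s\<^sub>i x)\<close> agrees modulo \<open>\<alpha>\<^sub>i\<close> both with
  \<open>p(x)\<close>, across an edge, and with \<open>s\<^sub>i p(s\<^sub>i x)\<close>, since \<open>s\<^sub>i\<close> is the identity modulo \<open>\<alpha>\<^sub>i\<close>.
  The numerator satisfies the divisibility condition for each edge label \<open>\<beta>\<close>; for \<open>\<beta> \<noteq> \<alpha>\<^sub>i\<close> the factor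
  \<open>\<alpha>\<^sub>i\<close> can be cancelled, as non-proportional linear forms are coprime (\<open>lin_dvd_cancel\<close>).  For \<open>\<beta> = \<alpha>\<^sub>i\<close>
  one uses that \<open>\<delta>\<^sub>i p\<close> is fixed by \<open>s\<^sub>i\<close> (\<open>divdiff_s_coset\<close>), because numerator and denominator both
  change sign; this also gives \<open>\<delta>\<^sub>i\<^sup>2 = 0\<close>.  The Leibniz formula is an identity between numerators.

  The formula for flow-up classes rests on one rigidity principle (\<open>lowest_support_length\<close>).  Let \<open>f\<close> be a
  nonzero homogeneous class and \<open>x\<close> a coset of least length at which \<open>f\<close> does not vanish.  Every edge out of \<open>x\<close>
  ends at a shorter coset, where \<open>f\<close> vanishes, so \<open>f(x)\<close> is divisible by each of the \<open>\<ell>(x)\<close> pairwise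
  coprime labels of these edges, hence by their product.  The degree of \<open>f\<close> is therefore at least
  \<open>\<ell>(x)\<close>: a nonzero class of small degree is nonzero at some short coset.

  The class \<open>\<delta>\<^sub>i p\<^sub>[\<^sub>v\<^sub>]\<close> has degree \<open>\<ell>([v]) - 1\<close>, so if it is nonzero it is nonzero at some \<open>x\<close> shorter than
  \<open>[v]\<close>.  There \<open>p\<^sub>[\<^sub>v\<^sub>](x) = 0\<close>, so \<open>p\<^sub>[\<^sub>v\<^sub>](s\<^sub>i x) \<noteq> 0\<close>, and comparing lengths leaves only \<open>s\<^sub>i x = [v]\<close>
  (\<open>divdiff_flow_up_support\<close>).  So \<open>\<delta>\<^sub>i p\<^sub>[\<^sub>v\<^sub>] = 0\<close> unless \<open>[s\<^sub>i v]\<close> is shorter than \<open>[v]\<close>, which is the same as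
  \<open>[s\<^sub>i v] <\<^sub>P [v]\<close>.  In that case the inversions of \<open>v\<close> are \<open>\<alpha>\<^sub>i\<close> and the images under \<open>s\<^sub>i\<close> of those of
  \<open>s\<^sub>i v\<close>, so \<open>\<delta>\<^sub>i p\<^sub>[\<^sub>v\<^sub>]\<close> and \<open>p\<^sub>[\<^sub>s\<^sub>i\<^sub>v\<^sub>]\<close> agree at \<open>[s\<^sub>i v]\<close>; their difference vanishes there, and the same
  argument shows that it vanishes everywhere.

  Behind this stand three facts on Weyl groups, all drawn from the exchange property (\<open>exchange\<close>):
  length counts inversions, cosets have unique shortest elements, and the edges out of a coset
  correspond to the inversions of its shortest element.
\<close>

section \<open>The symmetric algebra\<close>

abbreviation clinear :: "(complex^'n \<Rightarrow> complex^'n) \<Rightarrow> bool" where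
  "clinear w \<equiv> Vector_Spaces.linear (*s) (*s) w"

lemma clinearI:
  assumes "\<And>x y. w (x + y) = w x + w y" "\<And>c x. w (c *s x) = c *s w x"
  shows "clinear w"
  using assms by unfold_locales auto

lemma clinear_add: "clinear w \<Longrightarrow> w (x + y) = w x + w y"
  and clinear_scale: "clinear w \<Longrightarrow> w (c *s x) = c *s w x"
  and clinear_sum: "clinear w \<Longrightarrow> w (sum g A) = (\<Sum>a\<in>A. w (g a))"
  and clinear_minus: "clinear w \<Longrightarrow> w (- x) = - w x"
  by (simp_all add: vec.linear_add vec.linear_scale vec.linear_sum vec.linear_neg)

lemma clinear_comp: "clinear v \<Longrightarrow> clinear w \<Longrightarrow> clinear (v \<circ> w)"
  by (rule clinearI) (simp_all add: clinear_add clinear_scale)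

lemma clinear_id: "clinear id"
  by (rule clinearI) simp_all

lemma axis_expansion: "(x :: complex^'n::finite) = (\<Sum>j\<in>UNIV. x $ j *s axis j 1)"
  by (simp add: vec_eq_iff axis_def if_distrib cong: if_cong)

lemma scal_simps: "scal 0 = 0" "scal 1 = 1" "scal (a + b) = scal a + scal b"
    "scal (a * b) = scal a * scal b"
  by (simp_all add: scal_def single_add mult_single)

lemma lin_add: "lin (x + y) = lin x + lin y"
  by (simp add: lin_def single_add sum.distrib)

lemma lin_scale: "lin (c *s x) = scal c * lin x"
  by (simp add: lin_def scal_def sum_distrib_left mult_single)

lemma lin_zero: "lin 0 = 0"
  by (simp add: lin_def)

lemma lin_minus: "lin (- x) = - lin x"
  by (simp add: lin_def single_uminus sum_negf)

lemma lin_sum: "lin (sum g A) = (\<Sum>a\<in>A. lin (g a))"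
  by (induction A rule: infinite_finite_induct) (simp_all add: lin_add lin_zero)

lemma lin_axis: "lin (axis j 1) = Poly_Mapping.single (Poly_Mapping.single j 1) 1"
proof -
  have "Poly_Mapping.single (Poly_Mapping.single k (1::nat)) (axis j (1::complex) $ k)
      = (if k = j then Poly_Mapping.single (Poly_Mapping.single j 1) 1 else 0)" for k
    by (simp add: axis_def)
  then show ?thesis unfolding lin_def by simp
qed

definition monomial_image :: "(complex^'n \<Rightarrow> complex^'n) \<Rightarrow> ('n::finite \<Rightarrow>\<^sub>0 nat) \<Rightarrow> 'n sym" where
  "monomial_image w m = (\<Prod>j\<in>UNIV. lin (w (axis j 1)) ^ Poly_Mapping.lookup m j)"

lemma monomial_image_add:
  "monomial_image w (m + n) = monomial_image w m * monomial_image w n"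
  by (simp add: monomial_image_def lookup_add power_add prod.distrib)

lemma single_eq_monomial: "Poly_Mapping.single m c = scal c * monomial_image id m"
proof -
  have pw: "Poly_Mapping.single (Poly_Mapping.single j 1) (1::complex) ^ k
      = Poly_Mapping.single (Poly_Mapping.single j k) 1" for j :: 'a and k
    by (induction k) (simp_all add: mult_single single_add[symmetric])
  have pr: "(\<Prod>j\<in>A. Poly_Mapping.single (g j) (1::complex)) = Poly_Mapping.single (\<Sum>j\<in>A. g j) 1"
    for A :: "'a set" and g :: "'a \<Rightarrow> 'a \<Rightarrow>\<^sub>0 nat"
    by (induction A rule: infinite_finite_induct) (simp_all add: mult_single)
  have sm: "(\<Sum>j\<in>UNIV. Poly_Mapping.single j (Poly_Mapping.lookup m j)) = m"
    by (rule poly_mapping_eqI) (simp add: lookup_sum lookup_single when_def)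
  show ?thesis
    by (simp add: monomial_image_def lin_axis pw[unfolded One_nat_def] pr sm scal_def mult_single)
qed

lemma poly_mapping_sum_single:
  fixes f :: "'a \<Rightarrow>\<^sub>0 'b::comm_monoid_add"
  shows "f = (\<Sum>m\<in>Poly_Mapping.keys f. Poly_Mapping.single m (Poly_Mapping.lookup f m))"
  by (rule poly_mapping_eqI) (auto simp: lookup_sum lookup_single when_def in_keys_iff)

text \<open>
  The symmetric algebra is generated by constants and variables.  This induction
  gives the composition of endomorphisms and congruences modulo a linear form without exponent vectors.
\<close>
lemma sym_induct [case_names scal var add mult]:
  fixes f :: "('n::finite) sym"
  assumes sc: "\<And>c. P (scal c)" and va: "\<And>j. P (lin (axis j 1))"
    and ad: "\<And>f g. P f \<Longrightarrow> P g \<Longrightarrow> P (f + g)" and mu: "\<And>f g. P f \<Longrightarrow> P g \<Longrightarrow> P (f * g)"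
  shows "P f"
proof -
  have one: "P 1" and zero: "P 0" using sc[of 1] sc[of 0] by (simp_all add: scal_simps)
  have pw: "P (lin (axis j 1) ^ k)" for j k
    by (induction k) (use one va mu in simp_all)
  have pr: "P (\<Prod>j\<in>A. lin (axis j 1) ^ k j)" for A and k :: "'n \<Rightarrow> nat"
    by (induction A rule: infinite_finite_induct) (use one pw mu in simp_all)
  have mono: "P (Poly_Mapping.single m c)" for m c
    unfolding single_eq_monomial monomial_image_def id_apply by (intro mu sc pr)
  have "P (\<Sum>m\<in>A. Poly_Mapping.single m (Poly_Mapping.lookup f m))" for A
    by (induction A rule: infinite_finite_induct) (use zero mono ad in simp_all)
  then show ?thesis by (subst poly_mapping_sum_single)
qed

lemma act_superset:
  assumes "finite S" "Poly_Mapping.keys f \<subseteq> S"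
  shows "act w f = (\<Sum>m\<in>S. scal (Poly_Mapping.lookup f m) * monomial_image w m)"
  unfolding act_def monomial_image_def
  using assms by (intro sum.mono_neutral_left) (auto simp: in_keys_iff scal_simps)

lemma act_add: "act w (f + g) = act w f + act w g"
proof -
  let ?S = "Poly_Mapping.keys f \<union> Poly_Mapping.keys g"
  have "act w h = (\<Sum>m\<in>?S. scal (Poly_Mapping.lookup h m) * monomial_image w m)"
    if "Poly_Mapping.keys h \<subseteq> ?S" for h
    using that by (intro act_superset) auto
  then show ?thesis
    using keys_add[of f g]
    by (simp add: lookup_add scal_simps distrib_right sum.distrib)
qed

lemma act_zero [simp]: "act w 0 = 0"
  by (simp add: act_def)

lemma act_sum: "act w (sum g A) = (\<Sum>a\<in>A. act w (g a))"
  by (induction A rule: infinite_finite_induct) (simp_all add: act_add)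

lemma act_single: "act w (Poly_Mapping.single m c) = scal c * monomial_image w m"
  using act_superset[of "{m}" "Poly_Mapping.single m c" w] by simp

text \<open>
  Both sides are bilinear, so it suffices to compare them on monomials, where the image of a sum
  of exponent vectors is a product.
\<close>
lemma act_mult: "act w (f * g) = act w f * act w g"
proof -
  have "act w (\<Sum>m\<in>A. \<Sum>n\<in>B. Poly_Mapping.single m (a m) * Poly_Mapping.single n (b n))
      = (\<Sum>m\<in>A. act w (Poly_Mapping.single m (a m))) * (\<Sum>n\<in>B. act w (Poly_Mapping.single n (b n)))"
    for A B and a b :: "('a \<Rightarrow>\<^sub>0 nat) \<Rightarrow> complex"
    by (simp add: act_sum act_single mult_single monomial_image_add scal_simps sum_product mult_ac)
  from this[where A = "Poly_Mapping.keys f" and B = "Poly_Mapping.keys g"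
      and a = "Poly_Mapping.lookup f" and b = "Poly_Mapping.lookup g"]
  show ?thesis
    by (simp only: sum_product[symmetric] act_sum[symmetric] poly_mapping_sum_single[symmetric])
qed

lemma act_scal: "act w (scal c) = scal c"
  by (simp add: scal_def act_single monomial_image_def mult_single)

lemma act_one: "act w 1 = 1"
  using act_scal[of w 1] by (simp add: scal_simps)

lemma act_uminus: "act w (- f) = - act w f"
  using act_add[of w f "- f"] by (simp add: add_eq_0_iff)

lemma act_diff: "act w (f - g) = act w f - act w g"
  using act_add[of w f "- g"] by (simp add: act_uminus)

lemma act_prod: "act w (prod g A) = (\<Prod>a\<in>A. act w (g a))"
  by (induction A rule: infinite_finite_induct) (simp_all add: act_mult act_one)

lemma act_lin_axis: "act w (lin (axis j 1)) = lin (w (axis j 1))"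
proof -
  have "monomial_image w (Poly_Mapping.single j 1) = (\<Prod>k\<in>UNIV. if k = j then lin (w (axis j 1)) else 1)"
    unfolding monomial_image_def by (intro prod.cong) (auto simp: lookup_single)
  then show ?thesis by (simp add: lin_axis act_single scal_simps)
qed

lemma act_lin:
  assumes "clinear w" shows "act w (lin x) = lin (w x)"
proof -
  have "act w (lin (\<Sum>j\<in>UNIV. x $ j *s axis j 1)) = lin (w (\<Sum>j\<in>UNIV. x $ j *s axis j 1))"
    by (simp add: lin_sum lin_scale act_sum act_mult act_scal act_lin_axis clinear_sum[OF assms]
        clinear_scale[OF assms])
  then show ?thesis by (simp only: axis_expansion[symmetric])
qed

lemma act_comp:
  assumes "clinear v" shows "act v (act w f) = act (v \<circ> w) f"
  by (induction f rule: sym_induct)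
    (simp_all add: act_add act_mult act_scal act_lin_axis act_lin[OF assms])

lemma act_id: "act id f = f"
  by (induction f rule: sym_induct) (simp_all add: act_add act_mult act_scal act_lin_axis)

text \<open>
  A linear map that moves every vector along \<open>\<alpha>\<close> is the identity modulo \<open>\<alpha>\<close>.  The case of
  reflections makes divided differences exist; the case of a projection with kernel spanned by \<open>\<alpha>\<close>
  turns divisibility by \<open>\<alpha>\<close> into vanishing under a substitution.
\<close>
lemma lin_dvd_act_diff:
  assumes "\<And>x. w x = x - \<phi> x *s \<alpha>"
  shows "lin \<alpha> dvd f - act w f"
proof (induction f rule: sym_induct)
  case (var j)
  have "lin (w (axis j 1)) = lin (axis j 1 + (- \<phi> (axis j 1)) *s \<alpha>)" by (simp add: assms)
  then have "lin (axis j 1) - lin (w (axis j 1)) = lin \<alpha> * (- scal (- \<phi> (axis j 1)))"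
    by (simp only: lin_add lin_scale) (simp add: mult.commute)
  then show ?case by (simp add: act_lin_axis)
next
  case (add f g)
  have "f + g - act w (f + g) = (f - act w f) + (g - act w g)" by (simp add: act_add)
  then show ?case using dvd_add[OF add] by (simp only:)
next
  case (mult f g)
  have "f * g - act w (f * g) = (f - act w f) * g + act w f * (g - act w g)"
    by (simp add: act_mult algebra_simps)
  then show ?case using dvd_add[OF dvd_mult2[OF mult(1)] dvd_mult[OF mult(2)]] by (simp only:)
qed (simp add: act_scal)

text \<open>
  If \<open>x\<close> has a nonzero coordinate \<open>j\<close> and \<open>m\<close> is a monomial of \<open>f\<close> with the largest exponent of the
  variable \<open>e\<^sub>j\<close>, then the only contribution to the coefficient of \<open>e\<^sub>j m\<close> in \<open>x f\<close> comes from multiplying \<open>m\<close> by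
  the term \<open>x\<^sub>j e\<^sub>j\<close>.
\<close>
lemma lin_mult_eq_0:
  assumes "x \<noteq> 0" "lin x * f = 0" shows "f = 0"
proof (rule ccontr)
  assume "f \<noteq> 0"
  obtain j where j: "x $ j \<noteq> 0" using assms(1) by (metis vec_eq_iff zero_index)
  let ?K = "Poly_Mapping.keys f" and ?e = "Poly_Mapping.single j (1::nat)"
  let ?deg = "\<lambda>m. Poly_Mapping.lookup m j"
  have K: "finite ?K" "?K \<noteq> {}" using \<open>f \<noteq> 0\<close> by simp_all
  have "Max (?deg ` ?K) \<in> ?deg ` ?K" using K by (intro Max_in) auto
  then obtain m where m: "m \<in> ?K" "?deg m = Max (?deg ` ?K)" by (metis imageE)
  have max: "?deg n \<le> ?deg m" if "n \<in> ?K" for n using that K(1) m(2) by simp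
  have other: "Poly_Mapping.lookup (Poly_Mapping.single (Poly_Mapping.single k 1) c * f) (?e + m) = 0"
    if "k \<noteq> j" for k c
  proof (rule ccontr)
    assume "\<not> ?thesis"
    then have "?e + m \<in> Poly_Mapping.keys (Poly_Mapping.single (Poly_Mapping.single k 1) c * f)"
      by (simp add: in_keys_iff)
    then obtain a n where an: "?e + m = a + n" "n \<in> ?K"
        "a \<in> Poly_Mapping.keys (Poly_Mapping.single (Poly_Mapping.single k (1::nat)) c)"
      using keys_mult by blast
    then have "a = Poly_Mapping.single k 1" by (simp split: if_splits)
    then have "?deg (?e + m) = ?deg n" using an that by (simp add: lookup_add lookup_single)
    then show False using max[OF an(2)] by (simp add: lookup_add)
  qed
  have same: "Poly_Mapping.lookup (Poly_Mapping.single ?e c * f) (?e + m) = c * Poly_Mapping.lookup f m" for c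
  proof -
    have "Poly_Mapping.single ?e c * f
        = (\<Sum>n\<in>?K. Poly_Mapping.single (?e + n) (c * Poly_Mapping.lookup f n))"
      by (subst (1) poly_mapping_sum_single[of f]) (simp only: sum_distrib_left mult_single)
    moreover have "Poly_Mapping.lookup \<dots> (?e + m) = c * Poly_Mapping.lookup f m"
      using m(1) by (simp add: lookup_sum lookup_single when_def)
    ultimately show ?thesis by simp
  qed
  have "Poly_Mapping.lookup (lin x * f) (?e + m) = (\<Sum>k\<in>UNIV. if k = j then x $ j * Poly_Mapping.lookup f m else 0)"
    unfolding lin_def sum_distrib_right lookup_sum
    by (intro sum.cong) (use other same in auto)
  then have "Poly_Mapping.lookup (lin x * f) (?e + m) = x $ j * Poly_Mapping.lookup f m" by simp
  with assms(2) j m(1) show False by (simp add: in_keys_iff)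
qed

lemma lin_mult_cancel:
  assumes "x \<noteq> 0" "lin x * f = lin x * g" shows "f = g"
  using lin_mult_eq_0[OF assms(1), of "f - g"] assms(2) by (simp add: right_diff_distrib)

text \<open>
  Project along \<open>\<alpha>\<close>: \<open>\<alpha>\<close> divides a polynomial exactly if the projection kills it, and the image of \<open>\<beta>\<close> is
  a nonzero linear form, hence not a zero divisor.
\<close>
lemma lin_dvd_cancel:
  assumes "lin \<alpha> dvd lin \<beta> * f" and "\<alpha> \<noteq> 0" and indep: "\<And>c. \<beta> \<noteq> c *s \<alpha>"
  shows "lin \<alpha> dvd f"
proof -
  obtain j where j: "\<alpha> $ j \<noteq> 0" using assms(2) by (metis vec_eq_iff zero_index)
  \<comment> \<open>the projection with kernel spanned by \<open>\<alpha>\<close> onto the hyperplane where coordinate \<open>j\<close> vanishes\<close>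
  define \<pi> where "\<pi> x = x - (x $ j / \<alpha> $ j) *s \<alpha>" for x
  have lin: "clinear \<pi>"
    by (rule clinearI) (simp_all add: \<pi>_def vec_eq_iff field_simps j)
  have "\<pi> \<alpha> = 0" using j by (simp add: \<pi>_def)
  moreover obtain g where "lin \<beta> * f = lin \<alpha> * g" using assms(1) by blast
  ultimately have "lin (\<pi> \<beta>) * act \<pi> f = 0"
    by (metis act_lin act_mult lin lin_zero mult_zero_left)
  moreover have "\<pi> \<beta> \<noteq> 0" using indep by (auto simp: \<pi>_def)
  ultimately have "act \<pi> f = 0" by (rule lin_mult_eq_0[rotated])
  then show ?thesis using lin_dvd_act_diff[of \<pi> "\<lambda>x. x $ j / \<alpha> $ j" \<alpha> f] by (simp add: \<pi>_def)
qed

lemma prod_lin_dvd: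
  assumes "finite A" "0 \<notin> A"
    and indep: "\<And>\<alpha> \<beta> c. \<alpha> \<in> A \<Longrightarrow> \<beta> \<in> A \<Longrightarrow> \<beta> = c *s \<alpha> \<Longrightarrow> \<beta> = \<alpha>"
    and "\<And>\<alpha>. \<alpha> \<in> A \<Longrightarrow> lin \<alpha> dvd f"
  shows "(\<Prod>\<alpha>\<in>A. lin \<alpha>) dvd f"
  using assms
proof (induction A arbitrary: f rule: finite_induct)
  case (insert \<alpha> A)
  obtain g where g: "f = lin \<alpha> * g" using insert.prems(3) by blast
  have "lin \<beta> dvd g" if "\<beta> \<in> A" for \<beta>
  proof (rule lin_dvd_cancel)
    show "lin \<beta> dvd lin \<alpha> * g" using insert.prems(3) that g by blast
    show "\<beta> \<noteq> 0" using insert.prems(1) that by blast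
    show "\<alpha> \<noteq> c *s \<beta>" for c
      using insert.prems(2)[of \<beta> \<alpha> c] that insert.hyps by (metis insertI1 insertI2)
  qed
  then have "(\<Prod>\<alpha>\<in>A. lin \<alpha>) dvd g" using insert.prems by (intro insert.IH) blast+
  then show ?case using insert.hyps g by (simp add: mult_dvd_mono)
qed simp

lemma prod_lin_mult_eq_0:
  assumes "finite A" "0 \<notin> A" "(\<Prod>\<alpha>\<in>A. lin \<alpha>) * f = 0" shows "f = 0"
  using assms
  by (induction A rule: finite_induct) (auto simp: mult.assoc dest: lin_mult_eq_0)

lemma homogeneousD:
  "homogeneous d f \<Longrightarrow> m \<in> Poly_Mapping.keys f \<Longrightarrow> (\<Sum>j\<in>UNIV. Poly_Mapping.lookup m j) = d"
  by (simp add: homogeneous_def)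

lemma homogeneous_zero [simp]: "homogeneous d 0"
  by (simp add: homogeneous_def)

lemma homogeneous_unique:
  "homogeneous d f \<Longrightarrow> homogeneous e f \<Longrightarrow> f \<noteq> 0 \<Longrightarrow> d = e"
  unfolding homogeneous_def by (metis all_not_in_conv keys_eq_empty)

lemma homogeneous_add: "homogeneous d f \<Longrightarrow> homogeneous d g \<Longrightarrow> homogeneous d (f + g)"
  using keys_add[of f g] unfolding homogeneous_def by blast

lemma homogeneous_uminus: "homogeneous d f \<Longrightarrow> homogeneous d (- f)"
  by (simp add: homogeneous_def in_keys_iff)

lemma homogeneous_diff: "homogeneous d f \<Longrightarrow> homogeneous d g \<Longrightarrow> homogeneous d (f - g)"
  using homogeneous_add[of d f "- g"] homogeneous_uminus[of d g] by simp

lemma homogeneous_sum: "(\<And>a. a \<in> A \<Longrightarrow> homogeneous d (g a)) \<Longrightarrow> homogeneous d (sum g A)"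
  by (induction A rule: infinite_finite_induct) (simp_all add: homogeneous_add)

lemma homogeneous_scal: "homogeneous 0 (scal c)"
  by (simp add: homogeneous_def scal_def)

lemma homogeneous_lin: "homogeneous 1 (lin x)"
  unfolding lin_def by (intro homogeneous_sum) (auto simp: homogeneous_def lookup_single when_def)

lemma homogeneous_mult:
  assumes "homogeneous d f" "homogeneous e g" shows "homogeneous (d + e) (f * g)"
  unfolding homogeneous_def
proof
  fix m assume "m \<in> Poly_Mapping.keys (f * g)"
  then obtain a b where "m = a + b" "a \<in> Poly_Mapping.keys f" "b \<in> Poly_Mapping.keys g"
    using keys_mult by blast
  with assms show "(\<Sum>j\<in>UNIV. Poly_Mapping.lookup m j) = d + e"
    by (simp add: lookup_add sum.distrib homogeneousD)
qed

lemma homogeneous_prod: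
  "(\<And>a. a \<in> A \<Longrightarrow> homogeneous (k a) (g a)) \<Longrightarrow> homogeneous (\<Sum>a\<in>A. k a) (prod g A)"
  by (induction A rule: infinite_finite_induct)
    (use homogeneous_scal[of 1] in \<open>simp_all add: homogeneous_mult scal_simps\<close>)

lemma homogeneous_prod_lin: "homogeneous (card A) (\<Prod>\<alpha>\<in>A. lin \<alpha>)"
  using homogeneous_prod[of A "\<lambda>_. 1" lin] by (simp add: homogeneous_lin[unfolded One_nat_def])

lemma homogeneous_act:
  assumes "homogeneous d f" shows "homogeneous d (act w f)"
  unfolding act_def
proof (rule homogeneous_sum)
  fix m assume m: "m \<in> Poly_Mapping.keys f"
  have pw: "homogeneous k (lin x ^ k)" for x :: "complex^'a" and k
    using homogeneous_prod[of "{..<k}" "\<lambda>_. 1" "\<lambda>_. lin x"]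
    by (simp add: homogeneous_lin[unfolded One_nat_def])
  have "homogeneous (0 + (\<Sum>j\<in>UNIV. Poly_Mapping.lookup m j))
     (scal (Poly_Mapping.lookup f m) * (\<Prod>j\<in>UNIV. lin (w (axis j 1)) ^ Poly_Mapping.lookup m j))"
    by (intro homogeneous_mult homogeneous_scal homogeneous_prod pw)
  with homogeneousD[OF assms m]
  show "homogeneous d (scal (Poly_Mapping.lookup f m) * (\<Prod>j\<in>UNIV. lin (w (axis j 1)) ^ Poly_Mapping.lookup m j))"
    by simp
qed

text \<open>
  The cofactor may be inhomogeneous: every monomial of a multiple of \<open>g\<close> has degree at least that of \<open>g\<close>.
\<close>
lemma homogeneous_multiple_degree:
  assumes "homogeneous k g" "homogeneous d f" "g dvd f" "f \<noteq> 0" shows "k \<le> d"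
proof -
  obtain m where m: "m \<in> Poly_Mapping.keys f" using assms(4) by (metis all_not_in_conv keys_eq_empty)
  moreover obtain h where "f = g * h" using assms(3) by blast
  ultimately obtain a b where "m = a + b" "a \<in> Poly_Mapping.keys g"
    using keys_mult by blast
  with homogeneousD[OF assms(1)] homogeneousD[OF assms(2) m] show ?thesis
    by (auto simp: lookup_add sum.distrib)
qed

lemma exact_quot_eqI:
  assumes "x \<noteq> 0" "f = lin x * q" shows "exact_quot f (lin x) = q"
  unfolding exact_quot_def using assms by (intro the_equality) (auto dest: lin_mult_cancel)

lemma lin_mult_exact_quot:
  assumes "x \<noteq> 0" "lin x dvd f" shows "lin x * exact_quot f (lin x) = f"
  using assms by (auto simp: exact_quot_eqI)

section \<open>Roots, reflections and the Weyl group\<close>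

lemma pairing_add: "pairing (x + y) h = pairing x h + pairing y h"
  by (simp add: pairing_def distrib_right sum.distrib)

lemma pairing_scale: "pairing (c *s x) h = c * pairing x h"
  by (simp add: pairing_def sum_distrib_left mult.assoc)

lemma pairing_diff: "pairing (x - y) h = pairing x h - pairing y h"
  by (simp add: pairing_def left_diff_distrib sum_subtractf)

lemma pairing_sum: "pairing (sum g A) h = (\<Sum>a\<in>A. pairing (g a) h)"
  by (induction A rule: infinite_finite_induct) (simp_all add: pairing_add, simp_all add: pairing_def)

lemma pairing_axis: "pairing (axis j 1) h = h $ j"
proof -
  have "axis j 1 $ k * h $ k = (if k = j then h $ j else 0)" for k by (simp add: axis_def)
  then show ?thesis by (simp add: pairing_def)
qed

lemma clinear_reflection_along: "clinear (reflection_along \<beta> h)"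
  by (rule clinearI)
    (simp_all add: reflection_along_def pairing_add pairing_scale vec_eq_iff algebra_simps)

text \<open>
  The composite of the two reflections along \<open>\<beta>\<close> is the transvection \<open>x \<mapsto> x + g(x) \<beta>\<close> with
  \<open>g(\<beta>) = 0\<close>.  Its powers would move a root with \<open>g(x) \<noteq> 0\<close> through infinitely many roots.
\<close>
lemma is_coroot_unique:
  assumes fin: "finite \<Phi>" and span: "vec.span \<Phi> = UNIV" and "\<beta> \<noteq> 0"
    and h: "is_coroot \<Phi> \<beta> h" and h': "is_coroot \<Phi> \<beta> h'"
  shows "h = h'"
proof -
  define g where "g x = pairing x h' - pairing x h" for x
  have g_beta: "g \<beta> = 0" using h h' by (simp add: g_def is_coroot_def)
  have step: "y + g y *s \<beta> \<in> \<Phi>" if "y \<in> \<Phi>" for y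
  proof -
    have "reflection_along \<beta> h (reflection_along \<beta> h' y) \<in> \<Phi>"
      using h h' that unfolding is_coroot_def by blast
    moreover have "reflection_along \<beta> h (reflection_along \<beta> h' y) = y + g y *s \<beta>"
      using h by (simp add: reflection_along_def pairing_diff pairing_scale g_def is_coroot_def
          vec_eq_iff algebra_simps)
    ultimately show ?thesis by simp
  qed
  have g_zero: "g x = 0" if "x \<in> \<Phi>" for x
  proof (rule ccontr)
    assume "g x \<noteq> 0"
    define t where "t n = x + (of_nat n * g x) *s \<beta>" for n :: nat
    have g_t: "g (t n) = g x" for n
      using g_beta by (simp add: t_def g_def pairing_add pairing_scale)
    have t_Suc: "t (Suc n) = t n + g (t n) *s \<beta>" for n
      unfolding g_t by (simp add: t_def vec_eq_iff algebra_simps)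
    have "t n \<in> \<Phi>" for n
    proof (induction n)
      case 0 then show ?case using that by (simp add: t_def)
    next
      case (Suc n) then show ?case unfolding t_Suc by (rule step)
    qed
    then have "finite (range t)" using fin by (meson finite_subset image_subsetI)
    moreover have "inj t"
    proof (rule injI)
      fix m n assume "t m = t n"
      moreover obtain j where "\<beta> $ j \<noteq> 0" using \<open>\<beta> \<noteq> 0\<close> by (metis vec_eq_iff zero_index)
      ultimately show "m = n" using \<open>g x \<noteq> 0\<close> by (auto simp: t_def vec_eq_iff)
    qed
    ultimately show False using finite_imageD by blast
  qed
  have "g x = 0" for x
  proof -
    have "x \<in> vec.span \<Phi>" using span by simp
    then show ?thesis
      by (induction rule: vec.span_induct_alt)
        (use g_zero in \<open>auto simp: g_def pairing_add pairing_scale pairing_def[of 0]\<close>)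
  qed
  then have "pairing (axis j 1) h' = pairing (axis j 1) h" for j by (simp add: g_def)
  then show ?thesis by (simp add: pairing_axis vec_eq_iff)
qed

lemma generated_comp_closed:
  assumes "u \<in> generated S" "v \<in> generated S" shows "u \<circ> v \<in> generated S"
  using assms(1)
proof induction
  case generated_id
  then show ?case using assms(2) by simp
next
  case (generated_comp s w)
  then show ?case unfolding comp_assoc by (blast intro: generated.generated_comp)
qed

lemma generated_base: "s \<in> S \<Longrightarrow> s \<in> generated S"
  using generated_comp[OF _ generated_id, of s S] by simp

lemma generated_mono: "S \<subseteq> generated T \<Longrightarrow> generated S \<subseteq> generated T"
proof
  fix w assume "S \<subseteq> generated T" "w \<in> generated S"
  from this(2,1) show "w \<in> generated T"
    by induction (auto intro: generated_id generated_comp_closed)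
qed

lemma generated_involutions:
  assumes "\<And>s. s \<in> S \<Longrightarrow> s \<circ> s = id" and "w \<in> generated S"
  shows "bij w \<and> inv w \<in> generated S"
  using assms(2)
proof induction
  case (generated_comp s w)
  have "bij s" "inv s = s"
    using assms(1)[OF generated_comp(1)] by (auto intro: o_bij simp: inv_unique_comp)
  then show ?case using generated_comp
    by (metis bij_comp generated_base generated_comp_closed o_inv_distrib)
next
  case generated_id
  show ?case using generated.generated_id[of S] by (metis bij_id inv_id)
qed

locale root_datum =
  fixes D :: "('n::finite) flag_datum"
  assumes flag_datum: "flag_datum D"
begin

abbreviation \<Phi> where "\<Phi> \<equiv> roots D"
abbreviation pos where "pos \<equiv> pos_roots D"
abbreviation \<alpha> where "\<alpha> \<equiv> simple D"
abbreviation s where "s \<equiv> simple_refl D"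
abbreviation W where "W \<equiv> weyl D"
abbreviation WJ where "WJ \<equiv> weyl_par D"

lemma finite_roots: "finite \<Phi>" and zero_not_root: "0 \<notin> \<Phi>" and span_roots: "vec.span \<Phi> = UNIV"
  and root_multiples: "\<beta> \<in> \<Phi> \<Longrightarrow> c *s \<beta> \<in> \<Phi> \<Longrightarrow> c = 1 \<or> c = -1"
  and simple_root: "\<alpha> i \<in> \<Phi>"
  and pos_or_neg: "\<beta> \<in> \<Phi> \<Longrightarrow> \<beta> \<in> pos \<or> - \<beta> \<in> pos"
  using flag_datum unfolding flag_datum_def reduced_root_system_def by blast+

lemma pos_root: "\<beta> \<in> pos \<Longrightarrow> \<beta> \<in> \<Phi>"
  by (simp add: pos_roots_def)

lemma finite_pos: "finite pos"
  using finite_roots by (rule finite_subset[rotated]) (auto simp: pos_root)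

lemma coroot:
  assumes "\<beta> \<in> \<Phi>"
  shows "is_coroot \<Phi> \<beta> (coroot D \<beta>)" and "\<gamma> \<in> \<Phi> \<Longrightarrow> pairing \<gamma> (coroot D \<beta>) \<in> \<int>"
proof -
  obtain h where h: "is_coroot \<Phi> \<beta> h" "\<forall>\<gamma>\<in>\<Phi>. pairing \<gamma> h \<in> \<int>"
    using flag_datum assms unfolding flag_datum_def reduced_root_system_def by blast
  have "\<beta> \<noteq> 0" using assms zero_not_root by auto
  then have "coroot D \<beta> = h" unfolding coroot_def
    by (intro the_equality h(1) is_coroot_unique[OF finite_roots span_roots _ _ h(1)])
  with h show "is_coroot \<Phi> \<beta> (coroot D \<beta>)" "\<gamma> \<in> \<Phi> \<Longrightarrow> pairing \<gamma> (coroot D \<beta>) \<in> \<int>"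
    by auto
qed

lemma coroot_eqI: "\<beta> \<in> \<Phi> \<Longrightarrow> is_coroot \<Phi> \<beta> h \<Longrightarrow> coroot D \<beta> = h"
  using is_coroot_unique[OF finite_roots span_roots] coroot(1) zero_not_root by metis

lemma refl_apply: "refl D \<beta> x = x - pairing x (coroot D \<beta>) *s \<beta>"
  by (simp add: refl_def reflection_along_def)

lemma clinear_refl: "clinear (refl D \<beta>)"
  unfolding refl_def by (rule clinear_reflection_along)

lemma pairing_coroot_self: "\<beta> \<in> \<Phi> \<Longrightarrow> pairing \<beta> (coroot D \<beta>) = 2"
  using coroot(1) by (simp add: is_coroot_def)

lemma refl_self: "\<beta> \<in> \<Phi> \<Longrightarrow> refl D \<beta> \<beta> = - \<beta>"
  by (simp add: refl_apply pairing_coroot_self vec_eq_iff)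

lemma refl_refl: "\<beta> \<in> \<Phi> \<Longrightarrow> refl D \<beta> (refl D \<beta> x) = x"
  by (simp add: refl_apply pairing_coroot_self pairing_diff pairing_scale vec_eq_iff algebra_simps)

lemma refl_involution: "\<beta> \<in> \<Phi> \<Longrightarrow> refl D \<beta> \<circ> refl D \<beta> = id"
  by (simp add: fun_eq_iff refl_refl)

lemma inv_refl: "\<beta> \<in> \<Phi> \<Longrightarrow> inv (refl D \<beta>) = refl D \<beta>"
  by (simp add: refl_involution inv_unique_comp)

lemma refl_root: "\<beta> \<in> \<Phi> \<Longrightarrow> \<gamma> \<in> \<Phi> \<Longrightarrow> refl D \<beta> \<gamma> \<in> \<Phi>"
  using coroot(1)[of \<beta>] by (auto simp: is_coroot_def refl_def)

lemma weyl_involutions: "r \<in> refl D ` \<Phi> \<Longrightarrow> r \<circ> r = id"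
  using refl_involution by blast

lemma weyl_id: "id \<in> W"
  by (simp add: weyl_def generated_id)

lemma weyl_comp: "v \<in> W \<Longrightarrow> w \<in> W \<Longrightarrow> v \<circ> w \<in> W"
  by (simp add: weyl_def generated_comp_closed)

lemma weyl_bij: "w \<in> W \<Longrightarrow> bij w" and weyl_inv: "w \<in> W \<Longrightarrow> inv w \<in> W"
  using generated_involutions[OF weyl_involutions] by (auto simp: weyl_def)

lemma refl_weyl: "\<beta> \<in> \<Phi> \<Longrightarrow> refl D \<beta> \<in> W"
  by (simp add: weyl_def generated_base)

lemma s_weyl: "s i \<in> W"
  by (simp add: refl_weyl simple_root)

lemma weyl_clinear: "w \<in> W \<Longrightarrow> clinear w"
  unfolding weyl_def
  by (induction rule: generated.induct) (blast intro: clinear_id clinear_comp clinear_refl)+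

lemma weyl_root: "w \<in> W \<Longrightarrow> \<beta> \<in> \<Phi> \<Longrightarrow> w \<beta> \<in> \<Phi>"
  unfolding weyl_def
  by (induction rule: generated.induct) (auto intro: refl_root)

lemma weyl_inv_apply: "w \<in> W \<Longrightarrow> inv w (w x) = x" "w \<in> W \<Longrightarrow> w (inv w x) = x"
  using weyl_bij by (auto simp: bij_is_inj bij_is_surj surj_f_inv_f)

lemma weyl_inv_comp: "w \<in> W \<Longrightarrow> inv w \<circ> w = id" "w \<in> W \<Longrightarrow> w \<circ> inv w = id"
  by (auto simp: fun_eq_iff weyl_inv_apply)

lemma inv_s_comp: "w \<in> W \<Longrightarrow> inv (s i \<circ> w) = inv w \<circ> s i"
  by (simp add: o_inv_distrib weyl_bij s_weyl inv_refl simple_root)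

lemma s_s: "s i (s i x) = x"
  by (simp add: refl_refl simple_root)

lemma s_s_comp: "s i \<circ> (s i \<circ> w) = w"
  by (simp add: fun_eq_iff s_s)

text \<open>
  By uniqueness of coroots, the transport of the coroot of \<open>\<beta>\<close> along \<open>w\<close> is the coroot of \<open>w \<beta>\<close>.
\<close>
lemma pairing_coroot_weyl:
  assumes "w \<in> W" "\<beta> \<in> \<Phi>"
  shows "pairing x (coroot D (w \<beta>)) = pairing (inv w x) (coroot D \<beta>)"
proof -
  define h where "h = (\<chi> j. pairing (inv w (axis j 1)) (coroot D \<beta>))"
  have lin: "clinear (inv w)" using assms by (simp add: weyl_inv weyl_clinear)
  have h: "pairing x h = pairing (inv w x) (coroot D \<beta>)" for x
  proof -
    have "pairing (inv w (\<Sum>j\<in>UNIV. x $ j *s axis j 1)) (coroot D \<beta>) = pairing x h"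
      by (simp only: clinear_sum[OF lin] clinear_scale[OF lin] pairing_sum pairing_scale)
        (simp add: h_def pairing_def)
    then show ?thesis by (simp only: axis_expansion[symmetric])
  qed
  have "reflection_along (w \<beta>) h x = w (refl D \<beta> (inv w x))" for x
    using weyl_clinear[OF assms(1)]
    by (simp add: reflection_along_def h refl_apply vec.linear_diff clinear_scale
        weyl_inv_apply[OF assms(1)])
  moreover have "w (refl D \<beta> (inv w x)) \<in> \<Phi>" if "x \<in> \<Phi>" for x
    using assms that weyl_root refl_root weyl_inv by metis
  ultimately have "is_coroot \<Phi> (w \<beta>) h"
    using assms by (simp add: is_coroot_def h weyl_inv_apply pairing_coroot_self image_subset_iff)
  then have "coroot D (w \<beta>) = h" by (rule coroot_eqI[OF weyl_root[OF assms]])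
  with h show ?thesis by simp
qed

lemma refl_weyl_image:
  assumes "w \<in> W" "\<beta> \<in> \<Phi>" shows "refl D (w \<beta>) \<circ> w = w \<circ> refl D \<beta>"
  using weyl_clinear[OF assms(1)] assms
  by (simp add: fun_eq_iff refl_apply pairing_coroot_weyl weyl_inv_apply vec.linear_diff clinear_scale)

lemma refl_uminus:
  assumes "\<beta> \<in> \<Phi>" shows "refl D (- \<beta>) = refl D \<beta>"
proof -
  have "refl D (- \<beta>) \<circ> refl D \<beta> = refl D \<beta> \<circ> refl D \<beta>"
    using refl_weyl_image[OF refl_weyl assms, OF assms] by (simp add: refl_self assms)
  then have "refl D (- \<beta>) \<circ> (refl D \<beta> \<circ> refl D \<beta>) = refl D \<beta> \<circ> (refl D \<beta> \<circ> refl D \<beta>)"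
    by (simp add: comp_assoc[symmetric])
  then show ?thesis by (simp add: refl_involution assms)
qed

lemma simple_coordinates_unique:
  assumes "(\<Sum>i\<in>UNIV. a i *s \<alpha> i) = (\<Sum>i\<in>UNIV. b i *s \<alpha> i)" shows "a = b"
proof -
  have inj: "inj \<alpha>" and ind: "vec.independent (range \<alpha>)"
    using flag_datum by (simp_all add: flag_datum_def)
  let ?u = "\<lambda>v. a (inv \<alpha> v) - b (inv \<alpha> v)"
  have "(\<Sum>v\<in>range \<alpha>. ?u v *s v) = (\<Sum>i\<in>UNIV. (a i - b i) *s \<alpha> i)"
    by (simp add: sum.reindex[OF inj] inv_f_f[OF inj])
  also have "\<dots> = 0"
    using assms by (simp add: vec.scale_left_diff_distrib sum_subtractf)
  finally have "?u v = 0" if "v \<in> range \<alpha>" for v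
    using vec.independentD[OF ind _ subset_refl, where u = ?u] that by simp
  then have "a i - b i = 0" for i by (metis inv_f_f[OF inj] rangeI)
  then show ?thesis by (simp add: fun_eq_iff)
qed

lemma pos_coordinates:
  assumes "\<beta> \<in> pos" obtains k :: "'n \<Rightarrow> nat" where "\<beta> = (\<Sum>i\<in>UNIV. of_nat (k i) *s \<alpha> i)"
  using assms by (auto simp: pos_roots_def)

lemma simple_coordinates: "\<alpha> i = (\<Sum>j\<in>UNIV. of_nat (if j = i then 1 else 0) *s \<alpha> j)"
proof -
  have "of_nat (if j = i then 1 else 0) *s \<alpha> j = (if j = i then \<alpha> i else 0)" for j by simp
  then show ?thesis by simp
qed

lemma simple_pos: "\<alpha> i \<in> pos"
  unfolding pos_roots_def
  by (rule CollectI, rule conjI, rule simple_root, rule exI, rule simple_coordinates)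

lemma pos_not_neg:
  assumes "\<beta> \<in> pos" shows "- \<beta> \<notin> pos"
proof
  assume "- \<beta> \<in> pos"
  then obtain l :: "'n \<Rightarrow> nat" where l: "- \<beta> = (\<Sum>i\<in>UNIV. of_nat (l i) *s \<alpha> i)"
    by (rule pos_coordinates)
  obtain k :: "'n \<Rightarrow> nat" where k: "\<beta> = (\<Sum>i\<in>UNIV. of_nat (k i) *s \<alpha> i)"
    using assms by (rule pos_coordinates)
  have "(\<Sum>i\<in>UNIV. (of_nat (k i) + of_nat (l i)) *s \<alpha> i) = \<beta> + - \<beta>"
    unfolding k[symmetric] l[symmetric] vec.scale_left_distrib sum.distrib ..
  also have "\<dots> = (\<Sum>i\<in>UNIV. 0 *s \<alpha> i)" by simp
  finally have "(\<lambda>i. of_nat (k i) + of_nat (l i) :: complex) = (\<lambda>i. 0)"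
    by (rule simple_coordinates_unique)
  then have "of_nat (k i + l i) = (0 :: complex)" for i by (simp add: fun_eq_iff)
  then have "k i = 0" for i by (metis add_is_0 of_nat_eq_0_iff)
  then have "\<beta> = 0" using k by simp
  then show False using assms pos_root zero_not_root by blast
qed

lemma not_pos_iff: "\<beta> \<in> \<Phi> \<Longrightarrow> \<beta> \<notin> pos \<longleftrightarrow> - \<beta> \<in> pos"
  using pos_or_neg pos_not_neg by blast

lemma pos_not_zero: "\<beta> \<in> pos \<Longrightarrow> \<beta> \<noteq> 0"
  using pos_root zero_not_root by blast

lemma pos_not_proportional:
  assumes "\<beta> \<in> pos" "\<gamma> \<in> pos" "\<gamma> = c *s \<beta>" shows "\<gamma> = \<beta>"
proof -
  have "c = 1 \<or> c = -1" using assms by (intro root_multiples) (auto dest: pos_root)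
  with assms pos_not_neg show ?thesis by (auto simp: vec.scale_minus_left)
qed

text \<open>
  A positive root other than \<open>\<alpha>\<^sub>i\<close> is not a multiple of \<open>\<alpha>\<^sub>i\<close>, so it has a positive coordinate at some
  \<open>j \<noteq> i\<close>, and \<open>s\<^sub>i\<close> leaves that coordinate unchanged.
\<close>
lemma s_pos:
  assumes "\<beta> \<in> pos" "\<beta> \<noteq> \<alpha> i" shows "s i \<beta> \<in> pos"
proof (rule ccontr)
  assume "s i \<beta> \<notin> pos"
  then have "- s i \<beta> \<in> pos"
    using assms pos_root refl_root simple_root not_pos_iff by blast
  then obtain l :: "'n \<Rightarrow> nat" where l: "- s i \<beta> = (\<Sum>j\<in>UNIV. of_nat (l j) *s \<alpha> j)"
    by (rule pos_coordinates)
  obtain k :: "'n \<Rightarrow> nat" where k: "\<beta> = (\<Sum>j\<in>UNIV. of_nat (k j) *s \<alpha> j)"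
    using assms(1) by (rule pos_coordinates)
  define c where "c = pairing \<beta> (coroot D (\<alpha> i))"
  have *: "(\<Sum>j\<in>UNIV. (of_nat (k j) + of_nat (l j)) *s \<alpha> j) = c *s \<alpha> i"
    unfolding vec.scale_left_distrib sum.distrib k[symmetric] l[symmetric]
    by (simp add: refl_apply c_def)
  also have "\<dots> = c *s (\<Sum>j\<in>UNIV. of_nat (if j = i then 1 else 0) *s \<alpha> j)"
    by (simp only: simple_coordinates[symmetric])
  also have "\<dots> = (\<Sum>j\<in>UNIV. (if j = i then c else 0) *s \<alpha> j)"
    unfolding vec.scale_sum_right by (intro sum.cong) auto
  finally have "(\<lambda>j. of_nat (k j) + of_nat (l j)) = (\<lambda>j. if j = i then c else 0)"
    by (rule simple_coordinates_unique)
  then have "of_nat (k j + l j) = (if j = i then c else 0)" for j by (simp add: fun_eq_iff)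
  then have "k j = 0" if "j \<noteq> i" for j using that by (metis add_is_0 of_nat_eq_0_iff)
  then have "\<beta> = (\<Sum>j\<in>UNIV. if j = i then of_nat (k i) *s \<alpha> i else 0)"
    unfolding k by (intro sum.cong) auto
  then have "\<beta> = of_nat (k i) *s \<alpha> i" by simp
  with assms simple_pos pos_not_proportional show False by blast
qed

lemma neg_s_iff:
  assumes "\<beta> \<in> pos" shows "s i \<beta> \<notin> pos \<longleftrightarrow> \<beta> = \<alpha> i"
  using assms s_pos[of \<beta> i] pos_not_neg[OF simple_pos] refl_self[OF simple_root] by auto

section \<open>Words, exchange and length\<close>

definition word :: "'n list \<Rightarrow> complex^'n \<Rightarrow> complex^'n" where
  "word is = foldr (\<lambda>i u. s i \<circ> u) is id"

lemma word_Nil [simp]: "word [] = id"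
  and word_Cons [simp]: "word (i # is) = s i \<circ> word is"
  by (simp_all add: word_def)

lemma word_append: "word (is @ js) = word is \<circ> word js"
  by (induction "is") (simp_all add: comp_assoc)

lemma word_weyl: "word is \<in> W"
  by (induction "is") (simp_all only: word_Nil word_Cons weyl_id weyl_comp s_weyl)

lemma generated_simple: "generated (s ` J) = {word is |is. set is \<subseteq> J}"
proof (intro equalityI subsetI)
  fix w assume "w \<in> generated (s ` J)"
  then show "w \<in> {word is |is. set is \<subseteq> J}"
  proof induction
    case generated_id
    have "id = word [] \<and> set [] \<subseteq> J" by simp
    then show ?case by blast
  next
    case (generated_comp r w)
    then obtain i "is" where "i \<in> J" "r = s i" "w = word is" "set is \<subseteq> J" by blast
    then have "r \<circ> w = word (i # is) \<and> set (i # is) \<subseteq> J" by simp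
    then show ?case by blast
  qed
next
  fix w assume "w \<in> {word is |is. set is \<subseteq> J}"
  then obtain "is" where "w = word is" "set is \<subseteq> J" by blast
  then show "w \<in> generated (s ` J)"
    by (induction "is" arbitrary: w) (auto intro: generated.intros)
qed

text \<open>
  Applying the letters to \<open>\<gamma>\<close> one after another, the root turns negative at some letter \<open>i\<close>.  Just before,
  it equals \<open>\<alpha>\<^sub>i\<close>, the only positive root that \<open>s\<^sub>i\<close> makes negative; hence the reflection in \<open>\<gamma>\<close> is conjugate to
  this \<open>s\<^sub>i\<close> by the letters already applied, and multiplying by it deletes the letter.  Keeping track of
  the letters lets the same statement serve the parabolic subgroups.
\<close>
lemma exchange:
  assumes "\<gamma> \<in> pos" "word is \<gamma> \<notin> pos"
  shows "\<exists>js. set js \<subseteq> set is \<and> length is = Suc (length js) \<and> word is \<circ> refl D \<gamma> = word js"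
  using assms(2)
proof (induction "is")
  case Nil
  then show ?case using assms(1) by simp
next
  case (Cons i "is")
  show ?case
  proof (cases "word is \<gamma> \<in> pos")
    case False
    from Cons.IH[OF this] obtain js where js: "set js \<subseteq> set is" "length is = Suc (length js)"
      and eq: "word is \<circ> refl D \<gamma> = word js" by blast
    have "word (i # is) \<circ> refl D \<gamma> = word (i # js)" by (simp only: word_Cons comp_assoc eq)
    moreover have "set (i # js) \<subseteq> set (i # is)" "length (i # is) = Suc (length (i # js))"
      using js by auto
    ultimately show ?thesis by (intro exI[of _ "i # js"] conjI)
  next
    case True
    then have "word is \<gamma> = \<alpha> i" using Cons.prems neg_s_iff by simp
    then have commute: "word is \<circ> refl D \<gamma> = s i \<circ> word is"
      using refl_weyl_image[OF word_weyl pos_root[OF assms(1)], of "is"] by simp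
    have "word (i # is) \<circ> refl D \<gamma> = word is"
      by (simp only: word_Cons comp_assoc commute s_s_comp)
    moreover have "set is \<subseteq> set (i # is)" "length (i # is) = Suc (length is)" by auto
    ultimately show ?thesis by (intro exI[of _ "is"] conjI)
  qed
qed

text \<open>
  The form \<open>B(x, y) = \<Sum>\<^sub>\<gamma> \<langle>x, \<gamma>\<^sup>\<or>\<rangle> \<langle>y, \<gamma>\<^sup>\<or>\<rangle>\<close> is invariant under reflections and positive on
  roots, where all pairings are integers.  Invariance gives \<open>2 B(\<alpha>\<^sub>i, \<beta>) = \<langle>\<beta>, \<alpha>\<^sub>i\<^sup>\<or>\<rangle> B(\<alpha>\<^sub>i, \<alpha>\<^sub>i)\<close>.  If no
  pairing were positive, then expanding one argument of \<open>B(\<beta>, \<beta>)\<close> in simple roots would give a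
  number that is not positive.
\<close>
lemma simple_pairing_positive:
  assumes "\<beta> \<in> pos" shows "\<exists>i. Re (pairing \<beta> (coroot D (\<alpha> i))) > 0"
proof (rule ccontr)
  assume "\<nexists>i. Re (pairing \<beta> (coroot D (\<alpha> i))) > 0"
  then have nonpos: "Re (pairing \<beta> (coroot D (\<alpha> i))) \<le> 0" for i by (meson not_less)
  define B where "B x y = (\<Sum>\<gamma>\<in>\<Phi>. pairing x (coroot D \<gamma>) * pairing y (coroot D \<gamma>))" for x y
  have B_diff: "B (x - y) z = B x z - B y z" and B_scale: "B (c *s x) y = c * B x y"
    for x y z c
    by (simp_all add: B_def pairing_diff pairing_scale left_diff_distrib sum_subtractf
        sum_distrib_left mult.assoc)
  have B_sum: "B (sum g UNIV) y = (\<Sum>a\<in>UNIV. B (g a) y)" for g :: "'n \<Rightarrow> _" and y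
    unfolding B_def pairing_sum sum_distrib_right by (rule sum.swap)
  have B_commute: "B x y = B y x" for x y by (simp add: B_def mult.commute)
  have B_refl: "B (s i x) (s i y) = B x y" for i x y
  proof -
    have "B (s i x) (s i y)
        = (\<Sum>\<gamma>\<in>\<Phi>. pairing x (coroot D (s i \<gamma>)) * pairing y (coroot D (s i \<gamma>)))"
      by (simp add: B_def pairing_coroot_weyl[OF s_weyl] inv_refl simple_root)
    also have "\<dots> = B x y"
      unfolding B_def
      by (rule sum.reindex_bij_witness[of _ "s i" "s i"]) (auto simp: s_s refl_root simple_root)
    finally show ?thesis .
  qed
  have B_nonneg: "Im (B x x) = 0" "Re (B x x) \<ge> 0"
    and B_pos: "Re (B x x) > 0" if x: "x \<in> \<Phi>" for x
  proof -
    have real: "Im (pairing x (coroot D \<gamma>)) = 0" if "\<gamma> \<in> \<Phi>" for \<gamma>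
      using coroot(2)[OF that x] by (auto elim: Ints_cases)
    then show "Im (B x x) = 0" by (simp add: B_def Im_sum)
    have Re_B: "Re (B x x) = (\<Sum>\<gamma>\<in>\<Phi>. (Re (pairing x (coroot D \<gamma>)))\<^sup>2)"
      unfolding B_def Re_sum by (intro sum.cong) (auto simp: real power2_eq_square)
    then show "Re (B x x) \<ge> 0" by (simp add: sum_nonneg)
    have "Re (B x x) \<ge> (Re (pairing x (coroot D x)))\<^sup>2"
      unfolding Re_B by (rule member_le_sum[OF x]) (simp_all add: finite_roots)
    then show "Re (B x x) > 0" using pairing_coroot_self[OF x] by simp
  qed
  have simple: "Re (B (\<alpha> i) \<beta>) \<le> 0" for i
  proof -
    let ?c = "pairing \<beta> (coroot D (\<alpha> i))"
    have "B (\<alpha> i) \<beta> = B (s i (\<alpha> i)) (s i \<beta>)" by (simp add: B_refl)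
    also have "\<dots> = B (- 1 *s \<alpha> i) (\<beta> - ?c *s \<alpha> i)"
      by (simp only: refl_self[OF simple_root]) (simp add: refl_apply vec.scale_minus_left)
    also have "\<dots> = - B (\<alpha> i) \<beta> + ?c * B (\<alpha> i) (\<alpha> i)"
      unfolding B_scale by (subst B_commute) (simp add: B_diff B_scale B_commute[of \<beta>])
    finally have "2 * B (\<alpha> i) \<beta> = ?c * B (\<alpha> i) (\<alpha> i)" by simp
    then have "2 * Re (B (\<alpha> i) \<beta>) = Re ?c * Re (B (\<alpha> i) (\<alpha> i))"
      using B_nonneg(1)[OF simple_root, of i] by (simp add: complex_eq_iff)
    moreover have "Re ?c * Re (B (\<alpha> i) (\<alpha> i)) \<le> 0"
      using nonpos B_nonneg(2)[OF simple_root] by (rule mult_nonpos_nonneg)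
    ultimately show ?thesis by simp
  qed
  obtain k :: "'n \<Rightarrow> nat" where k: "\<beta> = (\<Sum>i\<in>UNIV. of_nat (k i) *s \<alpha> i)"
    using assms by (rule pos_coordinates)
  have "B \<beta> \<beta> = (\<Sum>i\<in>UNIV. of_nat (k i) * B (\<alpha> i) \<beta>)"
    by (subst (1) k) (simp only: B_sum B_scale)
  then have "Re (B \<beta> \<beta>) = (\<Sum>i\<in>UNIV. real (k i) * Re (B (\<alpha> i) \<beta>))" by (simp add: Re_sum)
  also have "\<dots> \<le> 0" using simple by (intro sum_nonpos mult_nonneg_nonpos) auto
  finally show False using B_pos[OF pos_root[OF assms]] by simp
qed

text \<open>
  Induction on the height: a simple reflection with positive pairing lowers it, and the root stays
  positive as long as it is not simple.
\<close>
lemma pos_root_conjugate_simple: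
  fixes k :: "'n \<Rightarrow> nat"
  assumes "\<beta> \<in> pos" "\<beta> = (\<Sum>i\<in>UNIV. of_nat (k i) *s \<alpha> i)"
  shows "\<exists>is j. \<beta> = word is (\<alpha> j)"
  using assms
proof (induction "sum k UNIV" arbitrary: \<beta> k rule: less_induct)
  case less
  show ?case
  proof (cases "\<beta> \<in> range \<alpha>")
    case True
    then obtain j where "\<beta> = word [] (\<alpha> j)" by auto
    then show ?thesis by blast
  next
    case False
    obtain i where i: "Re (pairing \<beta> (coroot D (\<alpha> i))) > 0"
      using simple_pairing_positive[OF less.prems(1)] by blast
    define c where "c = pairing \<beta> (coroot D (\<alpha> i))"
    have pos: "s i \<beta> \<in> pos" using s_pos less.prems(1) False by blast
    then obtain l :: "'n \<Rightarrow> nat" where l: "s i \<beta> = (\<Sum>j\<in>UNIV. of_nat (l j) *s \<alpha> j)"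
      by (rule pos_coordinates)
    have "(\<Sum>j\<in>UNIV. of_nat (k j) *s \<alpha> j) = s i \<beta> + c *s \<alpha> i"
      using less.prems(2) by (simp add: refl_apply c_def)
    also have "\<dots> = s i \<beta> + c *s (\<Sum>j\<in>UNIV. of_nat (if j = i then 1 else 0) *s \<alpha> j)"
      by (simp only: simple_coordinates[symmetric])
    also have "\<dots> = (\<Sum>j\<in>UNIV. (of_nat (l j) + (if j = i then c else 0)) *s \<alpha> j)"
      unfolding vec.scale_left_distrib sum.distrib l[symmetric] vec.scale_sum_right
      by (intro arg_cong2[of _ _ _ _ "(+)"] sum.cong) auto
    finally have "(\<lambda>j. of_nat (k j)) = (\<lambda>j. of_nat (l j) + (if j = i then c else 0))"
      by (rule simple_coordinates_unique)
    then have kl: "of_nat (k j) = of_nat (l j) + (if j = i then c else 0)" for j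
      by (simp add: fun_eq_iff)
    have other: "l j = k j" if "j \<noteq> i" for j using kl[of j] that by simp
    have less_i: "l i < k i"
    proof -
      have "Re (of_nat (k i)) = Re (of_nat (l i) + c)" using kl[of i] by simp
      then show ?thesis using i by (simp add: c_def)
    qed
    have "l j \<le> k j" for j using other[of j] less_i by (cases "j = i") auto
    then have "sum l UNIV < sum k UNIV"
      using less_i by (intro sum_strict_mono_ex1) auto
    from less.hyps[OF this pos l] obtain "is" j where "s i \<beta> = word is (\<alpha> j)" by blast
    then have "s i (s i \<beta>) = word (i # is) (\<alpha> j)" by simp
    then have "\<beta> = word (i # is) (\<alpha> j)" by (simp only: s_s)
    then show ?thesis by blast
  qed
qed

text \<open>
  The Weyl group is introduced by all reflections, its length function by words in the simple ones;
  this lemma reconciles the two.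
\<close>
lemma weyl_generated_simple: "W = generated (range s)"
proof
  have "refl D \<beta> \<in> generated (range s)" if "\<beta> \<in> pos" for \<beta>
  proof -
    obtain k :: "'n \<Rightarrow> nat" where "\<beta> = (\<Sum>i\<in>UNIV. of_nat (k i) *s \<alpha> i)"
      by (rule pos_coordinates[OF \<open>\<beta> \<in> pos\<close>])
    with that obtain "is" j where b: "\<beta> = word is (\<alpha> j)" using pos_root_conjugate_simple by blast
    have word: "word is \<in> generated (range s)" by (auto simp: generated_simple)
    have "refl D \<beta> \<circ> (word is \<circ> inv (word is)) = word is \<circ> s j \<circ> inv (word is)"
      using refl_weyl_image[OF word_weyl simple_root, of "is" j] by (simp add: b comp_assoc[symmetric])
    then have "refl D \<beta> = word is \<circ> s j \<circ> inv (word is)"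
      by (simp add: weyl_inv_comp word_weyl)
    moreover have "inv (word is) \<in> generated (range s)"
      using generated_involutions[OF _ word] refl_involution[OF simple_root] by blast
    moreover have "s j \<in> generated (range s)" by (rule generated_base) blast
    ultimately show ?thesis using word generated_comp_closed by metis
  qed
  then have "refl D ` \<Phi> \<subseteq> generated (range s)"
    using pos_or_neg refl_uminus by (metis image_subsetI)
  then show "W \<subseteq> generated (range s)" unfolding weyl_def by (rule generated_mono)
  show "generated (range s) \<subseteq> W"
    using s_weyl unfolding weyl_def by (intro generated_mono) blast
qed

lemma weyl_word: "w \<in> W \<Longrightarrow> \<exists>is. w = word is"
  unfolding weyl_generated_simple generated_simple by blast

lemma len_le: "len D (word is) \<le> length is"
  unfolding len_def word_def by (rule Least_le) blast

lemma reduced_word: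
  assumes "w \<in> W" obtains "is" where "w = word is" "length is = len D w"
proof -
  obtain js where "w = word js" using weyl_word assms by blast
  then have "\<exists>k is. length is = k \<and> w = foldr (\<lambda>i u. s i \<circ> u) is id"
    unfolding word_def by blast
  from LeastI_ex[OF this] obtain "is" where "length is = len D w" "w = word is"
    unfolding len_def word_def by blast
  then show ?thesis using that by blast
qed

lemma len_s_le:
  assumes "w \<in> W" shows "len D (s i \<circ> w) \<le> Suc (len D w)"
  using reduced_word[OF assms] len_le by (metis length_Cons word_Cons)

lemma len_comp_refl_less:
  assumes "w \<in> W" "\<gamma> \<in> pos" "w \<gamma> \<notin> pos" shows "len D (w \<circ> refl D \<gamma>) < len D w"
proof -
  obtain "is" where "is": "w = word is" "length is = len D w" using reduced_word assms(1) by blast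
  with exchange[of \<gamma> "is"] assms obtain js where "length is = Suc (length js)" "w \<circ> refl D \<gamma> = word js"
    by blast
  with "is" len_le[of js] show ?thesis by simp
qed

definition inversions :: "(complex^'n \<Rightarrow> complex^'n) \<Rightarrow> (complex^'n) set" where
  "inversions w = {\<beta> \<in> pos. - inv w \<beta> \<in> pos}"

lemma finite_inversions: "finite (inversions w)"
  using finite_pos by (simp add: inversions_def)

lemma len_refl_comp_less:
  assumes "w \<in> W" "\<beta> \<in> inversions w" shows "len D (refl D \<beta> \<circ> w) < len D w"
proof -
  let ?\<gamma> = "- inv w \<beta>"
  have \<beta>: "\<beta> \<in> pos" and \<gamma>: "?\<gamma> \<in> pos" using assms(2) by (simp_all add: inversions_def)
  have w\<gamma>: "w ?\<gamma> = - \<beta>"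
    using weyl_clinear[OF assms(1)] by (simp add: clinear_minus weyl_inv_apply assms(1))
  then have "len D (w \<circ> refl D ?\<gamma>) < len D w"
    using assms(1) \<gamma> pos_not_neg[OF \<beta>] by (intro len_comp_refl_less) auto
  moreover have "refl D \<beta> \<circ> w = w \<circ> refl D ?\<gamma>"
    using refl_weyl_image[OF assms(1) pos_root[OF \<gamma>]] refl_uminus[OF pos_root[OF \<beta>]]
    by (simp add: w\<gamma>)
  ultimately show ?thesis by simp
qed

text \<open>
  The inverse of \<open>s\<^sub>i w\<close> is \<open>w\<^sup>-\<^sup>1 s\<^sub>i\<close>, and \<open>s\<^sub>i\<close> permutes the positive roots other than \<open>\<alpha>\<^sub>i\<close>.
  Besides the count of inversions, this gives the factor \<open>\<alpha>\<^sub>i\<close> that divides the value at \<open>[v]\<close> of the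
  flow-up class of \<open>[v]\<close> when \<open>s\<^sub>i\<close> shortens \<open>v\<close>.
\<close>
lemma inversions_s:
  assumes "w \<in> W" "\<alpha> i \<notin> inversions w"
  shows "inversions (s i \<circ> w) = insert (\<alpha> i) (s i ` inversions w)" "\<alpha> i \<notin> s i ` inversions w"
proof -
  have lin: "clinear (inv w)" using assms weyl_inv weyl_clinear by blast
  have "inv w (\<alpha> i) \<in> pos"
    using assms simple_pos[of i] not_pos_iff[of "inv w (\<alpha> i)"]
    by (auto simp: inversions_def weyl_root weyl_inv simple_root)
  then have simple: "\<alpha> i \<in> inversions (s i \<circ> w)"
    by (simp add: inversions_def simple_pos inv_s_comp assms(1) refl_self simple_root clinear_minus[OF lin])
  have to: "s i \<beta> \<in> inversions w" if "\<beta> \<in> inversions (s i \<circ> w)" "\<beta> \<noteq> \<alpha> i" for \<beta>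
    using that s_pos by (simp add: inversions_def inv_s_comp assms(1))
  have back_in: "s i \<beta> \<in> inversions (s i \<circ> w)" if "\<beta> \<in> inversions w" for \<beta>
    using that assms(2) s_pos[of \<beta> i] by (auto simp: inversions_def inv_s_comp assms(1) s_s)
  show "inversions (s i \<circ> w) = insert (\<alpha> i) (s i ` inversions w)"
    using simple to back_in by (auto simp: image_iff) (metis s_s)
  show "\<alpha> i \<notin> s i ` inversions w"
  proof
    assume "\<alpha> i \<in> s i ` inversions w"
    then obtain \<beta> where "\<alpha> i = s i \<beta>" "\<beta> \<in> pos" by (auto simp: inversions_def)
    then have "s i (\<alpha> i) \<in> pos" by (metis s_s)
    then show False using neg_s_iff[OF simple_pos] by blast
  qed
qed

lemma inj_s: "inj_on (s i) A"
  by (metis inj_onI s_s)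

text \<open>
  In a reduced word the first letter is not an inversion of the remaining word, which could otherwise be
  shortened; so each letter adds exactly one inversion.
\<close>
lemma len_eq_card_inversions:
  assumes "w \<in> W" shows "len D w = card (inversions w)"
  using assms
proof (induction "len D w" arbitrary: w rule: less_induct)
  case less
  obtain "is" where "is": "w = word is" "length is = len D w" using reduced_word less.prems by blast
  show ?case
  proof (cases "is")
    case Nil
    then have "inversions w = {}" using "is" pos_not_neg by (auto simp: inversions_def)
    with "is" Nil show ?thesis by simp
  next
    case (Cons i js)
    let ?v = "word js"
    have w: "w = s i \<circ> ?v" and len: "len D w = Suc (length js)" using "is" Cons by auto
    have "len D w \<le> Suc (len D ?v)" unfolding w by (rule len_s_le) (rule word_weyl)
    then have lenv: "len D w = Suc (len D ?v)" using len len_le[of js] by simp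
    then have notin: "\<alpha> i \<notin> inversions ?v"
      using len_refl_comp_less[OF word_weyl, of "\<alpha> i" js] w by auto
    have "card (inversions w) = Suc (card (inversions ?v))"
      unfolding w inversions_s(1)[OF word_weyl notin]
      using inversions_s(2)[OF word_weyl notin] by (simp add: finite_inversions card_image inj_s)
    with less.hyps[of ?v] lenv word_weyl show ?thesis by simp
  qed
qed

section \<open>Parabolic cosets and the moment graph\<close>

lemma WJ_words: "WJ = {word is |is. set is \<subseteq> par D}"
  unfolding weyl_par_def by (rule generated_simple)

lemma WJ_weyl: "u \<in> WJ \<Longrightarrow> u \<in> W"
  using WJ_words word_weyl by auto

lemma WJ_id: "id \<in> WJ" and WJ_comp: "u \<in> WJ \<Longrightarrow> v \<in> WJ \<Longrightarrow> u \<circ> v \<in> WJ"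
  and s_WJ: "j \<in> par D \<Longrightarrow> s j \<in> WJ"
  by (auto simp: weyl_par_def intro: generated_id generated_comp_closed generated_base)

lemma WJ_inv: "u \<in> WJ \<Longrightarrow> inv u \<in> WJ"
  unfolding weyl_par_def
  using generated_involutions[of "s ` par D"] refl_involution[OF simple_root] by blast

text \<open>
  Exchange in a word of \<open>u\<close> with letters in \<open>J\<close> deletes one of these letters, so \<open>u s\<^sub>\<gamma>\<close> is again in \<open>W\<^sub>J\<close>.
  Thus elements of \<open>W\<^sub>J\<close> change the sign only of roots of the parabolic subsystem.
\<close>
lemma refl_WJ:
  assumes "u \<in> WJ" "\<gamma> \<in> pos" "u \<gamma> \<notin> pos" shows "refl D \<gamma> \<in> WJ"
proof -
  obtain "is" where "is": "u = word is" "set is \<subseteq> par D" using assms(1) WJ_words by blast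
  with exchange[of \<gamma> "is"] assms obtain js where "set js \<subseteq> set is" "u \<circ> refl D \<gamma> = word js" by blast
  with "is" have "u \<circ> refl D \<gamma> \<in> WJ" using WJ_words by auto
  then have "inv u \<circ> (u \<circ> refl D \<gamma>) \<in> WJ" using assms(1) WJ_comp WJ_inv by blast
  then show ?thesis using assms(1) by (simp add: comp_assoc[symmetric] weyl_inv_comp WJ_weyl)
qed

text \<open>
  The last letter of a shortest word with letters in \<open>J\<close> works: were its simple root kept positive, the word
  without this letter would send it to a negative root, and exchange would give a shorter word for \<open>u\<close>.
\<close>
lemma WJ_descent:
  assumes "u \<in> WJ" "u \<noteq> id" shows "\<exists>j\<in>par D. u (\<alpha> j) \<notin> pos"
proof -
  let ?P = "\<lambda>is. u = word is \<and> set is \<subseteq> par D"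
  have "\<exists>is. ?P is" using assms(1) WJ_words by blast
  then obtain "is" where "is": "?P is" and least: "\<And>js. ?P js \<Longrightarrow> length is \<le> length js"
    using ex_has_least_nat[of ?P _ length] by blast
  obtain js j where js: "is = js @ [j]"
    using "is" assms(2) by (metis append_butlast_last_id word_Nil)
  have u: "u = word js \<circ> s j" using "is" js by (simp add: word_append)
  have "word js (\<alpha> j) \<in> pos"
  proof (rule ccontr)
    assume "word js (\<alpha> j) \<notin> pos"
    then obtain ks where ks: "set ks \<subseteq> set js" "length js = Suc (length ks)" "word js \<circ> s j = word ks"
      using exchange[OF simple_pos] by blast
    then have "?P ks" using "is" js u by auto
    then have "length is \<le> length ks" by (rule least)
    then show False using ks js by simp
  qed
  moreover have "u (\<alpha> j) = - word js (\<alpha> j)"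
    using weyl_clinear[OF word_weyl] by (simp add: u refl_self simple_root clinear_minus)
  ultimately have "u (\<alpha> j) \<notin> pos" using pos_not_neg by simp
  moreover have "j \<in> par D" using "is" js by simp
  ultimately show ?thesis by blast
qed

lemma coset_self: "w \<in> coset D w"
  unfolding coset_def using WJ_id by (metis comp_id image_eqI)

lemma coset_comp_WJ:
  assumes "u \<in> WJ" shows "coset D (w \<circ> u) = coset D w"
proof -
  have *: "coset D (v \<circ> u) \<subseteq> coset D v" if "u \<in> WJ" for u v
    using that WJ_comp by (auto simp: coset_def comp_assoc)
  have "w \<circ> u \<circ> inv u = w" using assms by (simp add: comp_assoc weyl_inv_comp WJ_weyl)
  then show ?thesis using *[OF assms, of w] *[OF WJ_inv[OF assms], of "w \<circ> u"] by simp
qed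

lemma coset_eq: "v \<in> coset D w \<Longrightarrow> coset D v = coset D w"
  using coset_comp_WJ by (auto simp: coset_def[of D w])

lemma coset_eqD: "coset D v = coset D w \<Longrightarrow> \<exists>u\<in>WJ. v = w \<circ> u"
  using coset_self[of v] by (auto simp: coset_def)

lemma coset_left: "(\<lambda>u. v \<circ> u) ` coset D w = coset D (v \<circ> w)"
  by (simp add: coset_def image_image comp_assoc)

lemma coset_left_cong: "coset D v = coset D w \<Longrightarrow> coset D (u \<circ> v) = coset D (u \<circ> w)"
  by (metis coset_left)

lemma coset_in_cosets: "w \<in> W \<Longrightarrow> coset D w \<in> cosets D"
  by (simp add: cosets_def)

text \<open>
  A nontrivial \<open>u\<close> makes some \<open>\<alpha>\<^sub>j\<close> with \<open>j \<in> J\<close> negative; put \<open>\<gamma> = - u \<alpha>\<^sub>j\<close>.  Minimality of \<open>w u\<close> makes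
  \<open>w u \<alpha>\<^sub>j\<close> positive, so \<open>w \<gamma>\<close> is negative and \<open>w s\<^sub>\<gamma>\<close> is shorter than \<open>w\<close>.  But \<open>s\<^sub>\<gamma> \<in> W\<^sub>J\<close>, so \<open>w s\<^sub>\<gamma>\<close> lies in
  the coset of \<open>w\<close>.
\<close>
lemma minimal_rep_unique:
  assumes "w \<in> W" and u: "u \<in> WJ"
    and w: "\<And>v. v \<in> coset D w \<Longrightarrow> len D w \<le> len D v" and wu: "\<And>v. v \<in> coset D w \<Longrightarrow> len D (w \<circ> u) \<le> len D v"
  shows "u = id"
proof (rule ccontr)
  assume "u \<noteq> id"
  then obtain j where j: "j \<in> par D" "u (\<alpha> j) \<notin> pos" using WJ_descent u by blast
  have uW: "u \<in> W" using u WJ_weyl by blast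
  define \<gamma> where "\<gamma> = - u (\<alpha> j)"
  have \<gamma>: "\<gamma> \<in> pos" using j uW not_pos_iff by (simp add: \<gamma>_def weyl_root simple_root)
  have in_coset: "w \<circ> v \<in> coset D w" if "v \<in> WJ" for v using that by (simp add: coset_def)
  have "inv u \<gamma> \<notin> pos"
    using weyl_clinear[OF weyl_inv[OF uW]] pos_not_neg[OF simple_pos]
    by (simp add: \<gamma>_def clinear_minus weyl_inv_apply uW)
  then have refl_\<gamma>: "refl D \<gamma> \<in> WJ" using \<gamma> u refl_WJ WJ_inv by blast
  have "(w \<circ> u) (\<alpha> j) \<in> pos"
  proof (rule ccontr)
    assume "(w \<circ> u) (\<alpha> j) \<notin> pos"
    then have "len D (w \<circ> u \<circ> s j) < len D (w \<circ> u)"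
      using assms(1) uW simple_pos by (intro len_comp_refl_less weyl_comp)
    then show False using wu[OF in_coset] u j s_WJ WJ_comp by (metis comp_assoc leD)
  qed
  then have "w \<gamma> \<notin> pos"
    using weyl_clinear[OF assms(1)] pos_not_neg by (simp add: \<gamma>_def clinear_minus)
  then have "len D (w \<circ> refl D \<gamma>) < len D w" using assms(1) \<gamma> by (intro len_comp_refl_less)
  then show False using w[OF in_coset[OF refl_\<gamma>]] by simp
qed

lemma min_rep:
  assumes "x \<in> cosets D"
  shows min_rep_le: "u \<in> x \<Longrightarrow> len D (min_rep D x) \<le> len D u"
    and min_rep_weyl: "min_rep D x \<in> W" and coset_min_rep: "coset D (min_rep D x) = x"
    and min_rep_eqI: "w \<in> x \<Longrightarrow> (\<And>u. u \<in> x \<Longrightarrow> len D w \<le> len D u) \<Longrightarrow> min_rep D x = w"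
proof -
  obtain v where v: "v \<in> W" "x = coset D v" using assms by (auto simp: cosets_def)
  have weyl: "w \<in> W" if "w \<in> x" for w
    using that v WJ_weyl weyl_comp by (auto simp: coset_def)
  let ?P = "\<lambda>w. w \<in> x \<and> (\<forall>u\<in>x. len D w \<le> len D u)"
  have unique: "w' = w" if "?P w" "?P w'" for w w'
  proof -
    have x: "coset D w = x" "coset D w' = x" using that coset_eq v by auto
    then obtain u where "u \<in> WJ" "w' = w \<circ> u" using coset_eqD[of w' w] by auto
    with minimal_rep_unique[of w u] that x weyl show ?thesis by auto
  qed
  have "\<exists>w. ?P w" using ex_has_least_nat[of "\<lambda>w. w \<in> x" v "len D"] v coset_self by blast
  then have "\<exists>!w. ?P w" using unique by metis
  then have P: "?P (min_rep D x)" unfolding min_rep_def by (rule theI')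
  then have eq: "\<And>w. ?P w \<Longrightarrow> min_rep D x = w" using unique by simp
  show "u \<in> x \<Longrightarrow> len D (min_rep D x) \<le> len D u" using P by blast
  show "min_rep D x \<in> W" "coset D (min_rep D x) = x" using P weyl coset_eq v by blast+
  show "w \<in> x \<Longrightarrow> (\<And>u. u \<in> x \<Longrightarrow> len D w \<le> len D u) \<Longrightarrow> min_rep D x = w" using eq by blast
qed

abbreviation coset_len where "coset_len x \<equiv> len D (min_rep D x)"

abbreviation out_labels where "out_labels x \<equiv> inversions (min_rep D x)"

text \<open>
  The direction of an edge between distinct cosets does not depend on the representative: if passing from
  \<open>v\<close> to \<open>w\<close> changed the sign of the root, the root would belong to the parabolic subsystem and the
  edge would be a loop.
\<close>
lemma inversion_coset_invariant:
  assumes "v \<in> W" "w \<in> W" "coset D v = coset D w" "\<beta> \<in> inversions v"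
    and "coset D (refl D \<beta> \<circ> v) \<noteq> coset D v"
  shows "\<beta> \<in> inversions w"
proof (rule ccontr)
  assume "\<beta> \<notin> inversions w"
  obtain u where u: "u \<in> WJ" "v = w \<circ> u" using assms(3) coset_eqD by blast
  have \<beta>: "\<beta> \<in> pos" "- inv v \<beta> \<in> pos" using assms(4) by (simp_all add: inversions_def)
  have root: "inv w \<beta> \<in> \<Phi>" using assms(2) \<beta> pos_root weyl_root weyl_inv by blast
  have \<gamma>: "inv w \<beta> \<in> pos"
    using \<open>\<beta> \<notin> inversions w\<close> not_pos_iff[OF root] \<beta> by (auto simp: inversions_def)
  have "inv v \<beta> = inv u (inv w \<beta>)"
    using u assms(2) by (simp add: o_inv_distrib weyl_bij WJ_weyl)
  then have "inv u (inv w \<beta>) \<notin> pos" using \<beta>(2) pos_not_neg by fastforce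
  then have "refl D (inv w \<beta>) \<in> WJ" using refl_WJ[OF WJ_inv[OF u(1)] \<gamma>] by blast
  then have "coset D (refl D \<beta> \<circ> w) = coset D w"
    using refl_weyl_image[OF assms(2) root] coset_comp_WJ by (simp add: weyl_inv_apply assms(2))
  then show False using assms(3,5) coset_left_cong by metis
qed

lemma out_edge_shorter:
  assumes "x \<in> cosets D" "\<beta> \<in> out_labels x"
  defines "y \<equiv> coset D (refl D \<beta> \<circ> min_rep D x)"
  shows "y \<in> cosets D" "coset_len y < coset_len x"
proof -
  have "\<beta> \<in> \<Phi>" using assms(2) pos_root by (simp add: inversions_def)
  then have W: "refl D \<beta> \<circ> min_rep D x \<in> W" using assms(1) weyl_comp refl_weyl min_rep_weyl by blast
  then show y: "y \<in> cosets D" unfolding y_def by (rule coset_in_cosets)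
  have "coset_len y \<le> len D (refl D \<beta> \<circ> min_rep D x)"
    using y coset_self by (intro min_rep_le) (simp_all add: y_def)
  also have "\<dots> < coset_len x" using assms by (intro len_refl_comp_less min_rep_weyl)
  finally show "coset_len y < coset_len x" .
qed

lemma moment_edge_iff:
  assumes x: "x \<in> cosets D"
  shows "moment_edge D x \<beta> y \<longleftrightarrow> \<beta> \<in> out_labels x \<and> y = coset D (refl D \<beta> \<circ> min_rep D x)"
proof -
  let ?m = "min_rep D x"
  have m: "?m \<in> W" "coset D ?m = x" using x min_rep_weyl coset_min_rep by blast+
  have out: "\<beta> \<in> inversions ?m \<and> coset D (refl D \<beta> \<circ> w) = coset D (refl D \<beta> \<circ> ?m)"
    if "w \<in> W" "x = coset D w" "\<beta> \<in> inversions w" "coset D (refl D \<beta> \<circ> w) \<noteq> coset D w"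
    for \<beta> w
    using that m inversion_coset_invariant coset_left_cong by metis
  show ?thesis
  proof
    assume "moment_edge D x \<beta> y"
    then show "\<beta> \<in> inversions ?m \<and> y = coset D (refl D \<beta> \<circ> ?m)"
    proof cases
      case (edge_from w)
      then show ?thesis using out[of w \<beta>] by (simp add: inversions_def)
    next
      case (edge_to w)
      \<comment> \<open>seen from its source, the edge is given by the other representative \<open>s\<^sub>\<beta> w\<close>\<close>
      let ?v = "refl D \<beta> \<circ> w"
      have root: "\<beta> \<in> \<Phi>" using edge_to pos_root by blast
      have v: "?v \<in> W" using edge_to root by (intro weyl_comp refl_weyl)
      have cancel: "refl D \<beta> \<circ> ?v = w" by (simp add: fun_eq_iff refl_refl root)
      have "inv ?v = inv w \<circ> refl D \<beta>"
        using edge_to(3) root by (simp add: o_inv_distrib weyl_bij refl_weyl inv_refl)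
      then have "inv ?v \<beta> = - inv w \<beta>"
        using weyl_clinear[OF weyl_inv[OF edge_to(3)]] by (simp add: refl_self root clinear_minus)
      moreover have "inv w \<beta> \<in> pos"
        using edge_to root not_pos_iff weyl_root weyl_inv by blast
      ultimately have "\<beta> \<in> inversions ?v" using edge_to by (simp add: inversions_def)
      then show ?thesis using out[OF v edge_to(1)] edge_to by (simp add: cancel)
    qed
  next
    assume R: "\<beta> \<in> inversions ?m \<and> y = coset D (refl D \<beta> \<circ> ?m)"
    then have "coset_len y < coset_len x" using x out_edge_shorter by blast
    then have "coset D (refl D \<beta> \<circ> ?m) \<noteq> coset D ?m" using R m by auto
    then have "moment_edge D (coset D ?m) \<beta> (coset D (refl D \<beta> \<circ> ?m))"
      using R m by (intro edge_from) (simp_all add: inversions_def)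
    then show "moment_edge D x \<beta> y" using R m by simp
  qed
qed

lemma prod_out_edges:
  assumes "x \<in> cosets D"
  shows "(\<Prod>(\<beta>, y)\<in>{(\<beta>, y). moment_edge D x \<beta> y}. lin \<beta>) = (\<Prod>\<beta>\<in>out_labels x. lin \<beta>)"
proof -
  have edges: "{(\<beta>, y). moment_edge D x \<beta> y}
      = (\<lambda>\<beta>. (\<beta>, coset D (refl D \<beta> \<circ> min_rep D x))) ` out_labels x"
    using assms by (auto simp: moment_edge_iff)
  show ?thesis unfolding edges by (subst prod.reindex) (auto simp: inj_on_def)
qed

lemma card_out_labels: "x \<in> cosets D \<Longrightarrow> card (out_labels x) = coset_len x"
  using len_eq_card_inversions min_rep_weyl by simp

lemma le_P_len:
  assumes "le_P D x y" "x \<in> cosets D" "y \<in> cosets D" "x \<noteq> y"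
  shows "coset_len x < coset_len y"
proof -
  have "min_rep D x = min_rep D y \<or> coset_len x < coset_len y"
    using assms(1) unfolding le_P_def bruhat_le_def
    by (induction rule: rtranclp_induct) (auto simp: bruhat_step_def)
  then show ?thesis using assms coset_min_rep by metis
qed

text \<open>
  Let \<open>u\<close> be the shortest element of the shorter coset.  Then \<open>s\<^sub>i u\<close> lies in \<open>x\<close> and is at most one letter longer
  than \<open>u\<close>, so it is a shortest element of \<open>x\<close>; by uniqueness it is the given one.
\<close>
lemma min_rep_s_shorter:
  assumes "x \<in> cosets D" "coset_len (coset D (s i \<circ> min_rep D x)) < coset_len x"
  shows "min_rep D (coset D (s i \<circ> min_rep D x)) = s i \<circ> min_rep D x"
proof -
  let ?w = "min_rep D x" let ?y = "coset D (s i \<circ> ?w)" let ?u = "min_rep D ?y"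
  have w: "?w \<in> W" "coset D ?w = x" using assms(1) min_rep_weyl coset_min_rep by blast+
  have y: "?y \<in> cosets D" using w by (intro coset_in_cosets weyl_comp s_weyl)
  then have u: "?u \<in> W" "coset D ?u = ?y" using min_rep_weyl coset_min_rep by blast+
  have "coset D (s i \<circ> ?u) = coset D (s i \<circ> (s i \<circ> ?w))" using u(2) by (rule coset_left_cong)
  also have "\<dots> = x" using w by (simp add: s_s_comp)
  finally have su: "s i \<circ> ?u \<in> x" using coset_self[of "s i \<circ> ?u"] by simp
  have "?w = s i \<circ> ?u"
  proof (rule min_rep_eqI[OF assms(1) su])
    fix v assume "v \<in> x"
    have "len D (s i \<circ> ?u) \<le> len D ?w" using len_s_le[OF u(1), of i] assms(2) by simp
    also have "\<dots> \<le> len D v" using min_rep_le assms(1) \<open>v \<in> x\<close> by blast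
    finally show "len D (s i \<circ> ?u) \<le> len D v" .
  qed
  then have "s i \<circ> ?w = s i \<circ> (s i \<circ> ?u)" by (rule arg_cong)
  then show ?thesis by (simp add: s_s_comp)
qed

text \<open>
  If the length drops, then \<open>s\<^sub>i w\<close> is itself a shortest element, so left multiplication by \<open>s\<^sub>i\<close> is a single
  Bruhat step between the shortest elements of the two cosets.
\<close>
lemma less_P_s_iff:
  fixes i :: 'n
  assumes "x \<in> cosets D"
  defines "y \<equiv> coset D (s i \<circ> min_rep D x)"
  shows "less_P D y x \<longleftrightarrow> coset_len y < coset_len x"
proof
  have w: "min_rep D x \<in> W" using assms(1) min_rep_weyl by blast
  then have y: "y \<in> cosets D" unfolding y_def by (intro coset_in_cosets weyl_comp s_weyl)
  then show "coset_len y < coset_len x" if "less_P D y x"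
    using that assms(1) le_P_len by (simp add: less_P_def)
  assume less: "coset_len y < coset_len x"
  then have m: "min_rep D y = s i \<circ> min_rep D x"
    using assms min_rep_s_shorter by blast
  have "bruhat_step D (s i \<circ> min_rep D x) (s i \<circ> (s i \<circ> min_rep D x))"
    unfolding bruhat_step_def
    using less m by (intro conjI bexI[of _ "\<alpha> i"] weyl_comp s_weyl w simple_pos) (simp_all add: s_s_comp)
  then have "le_P D y x" by (simp add: le_P_def bruhat_le_def m s_s_comp)
  then show "less_P D y x" using less by (auto simp: less_P_def)
qed

section \<open>Divided differences on equivariant cohomology\<close>

lemma act_s_lin: "act (s i) (lin (\<alpha> i)) = - lin (\<alpha> i)"
  by (simp add: act_lin clinear_refl refl_self simple_root lin_minus)

lemma simple_nonzero: "\<alpha> i \<noteq> 0"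
  using simple_pos pos_not_zero by blast

lemma act_s_s: "act (s i) (act (s i) f) = f"
  by (simp add: act_comp clinear_refl refl_involution simple_root act_id)

lemma lin_dvd_act_refl_diff: "lin \<beta> dvd f - act (refl D \<beta>) f"
  by (rule lin_dvd_act_diff) (rule refl_apply)

definition s_coset where "s_coset i x = (\<lambda>u. s i \<circ> u) ` x"

lemma s_coset_coset: "s_coset i (coset D w) = coset D (s i \<circ> w)"
  by (simp add: s_coset_def coset_left)

lemma s_coset_s_coset: "s_coset i (s_coset i x) = x"
  by (simp add: s_coset_def image_image s_s_comp)

lemma s_coset_in_cosets_iff: "s_coset i x \<in> cosets D \<longleftrightarrow> x \<in> cosets D"
proof -
  have "s_coset i x \<in> cosets D" if "x \<in> cosets D" for x
    using that s_weyl weyl_comp by (auto simp: cosets_def s_coset_coset)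
  then show ?thesis using s_coset_s_coset by metis
qed

lemma weyl_act_s: "weyl_act (s i) p x = act (s i) (p (s_coset i x))"
  by (simp add: weyl_act_def s_coset_def inv_refl simple_root)

lemma HT_zero: "p \<in> HT D \<Longrightarrow> x \<notin> cosets D \<Longrightarrow> p x = 0"
  by (simp add: HT_def)

lemma HT_edge:
  assumes "p \<in> HT D" "w \<in> W" "\<beta> \<in> pos"
  shows "lin \<beta> dvd p (coset D (refl D \<beta> \<circ> w)) - p (coset D w)"
  using assms by (cases "coset D (refl D \<beta> \<circ> w) = coset D w") (auto simp: HT_def)

lemma HT_edge_root:
  assumes "p \<in> HT D" "w \<in> W" "\<beta> \<in> \<Phi>"
  shows "lin \<beta> dvd p (coset D (refl D \<beta> \<circ> w)) - p (coset D w)"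
proof (cases "\<beta> \<in> pos")
  case False
  then have "lin (- \<beta>) dvd p (coset D (refl D (- \<beta>) \<circ> w)) - p (coset D w)"
    using assms not_pos_iff HT_edge by blast
  then show ?thesis using assms by (simp add: refl_uminus lin_minus)
qed (use assms HT_edge in blast)

lemma lin_dvd_divdiff_numerator:
  assumes "p \<in> HT D"
  shows "lin (\<alpha> i) dvd p x - weyl_act (s i) p x"
proof (cases "x \<in> cosets D")
  case True
  then obtain w where w: "w \<in> W" "x = coset D w" by (auto simp: cosets_def)
  have "p x - weyl_act (s i) p x
      = (p (s_coset i x) - act (s i) (p (s_coset i x))) - (p (s_coset i x) - p x)"
    by (simp add: weyl_act_s)
  moreover have "lin (\<alpha> i) dvd p (s_coset i x) - p x"
    using HT_edge[OF assms w(1) simple_pos] by (simp add: w s_coset_coset)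
  ultimately show ?thesis using lin_dvd_act_refl_diff dvd_diff by metis
next
  case False
  then show ?thesis using HT_zero[OF assms] s_coset_in_cosets_iff by (simp add: weyl_act_s)
qed

lemma lin_mult_divdiff:
  assumes "p \<in> HT D"
  shows "lin (\<alpha> i) * divdiff D i p x = p x - act (s i) (p (s_coset i x))"
  unfolding divdiff_def using lin_mult_exact_quot[OF simple_nonzero lin_dvd_divdiff_numerator[OF assms]]
  by (simp add: weyl_act_s)

lemma divdiff_eqI:
  assumes "\<And>x. lin (\<alpha> i) * q x = p x - act (s i) (p (s_coset i x))"
  shows "divdiff D i p = q"
  unfolding divdiff_def by (rule ext, rule exact_quot_eqI) (simp_all add: simple_nonzero assms weyl_act_s)

text \<open>
  The reflection \<open>s\<^sub>i\<close> changes the sign of both \<open>p - s\<^sub>i p\<close> and \<open>\<alpha>\<^sub>i\<close>, so it fixes their quotient.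
\<close>
lemma divdiff_s_coset:
  assumes "p \<in> HT D"
  shows "divdiff D i p (s_coset i x) = act (s i) (divdiff D i p x)"
proof (rule lin_mult_cancel[OF simple_nonzero])
  have "lin (\<alpha> i) * act (s i) (divdiff D i p x) = - act (s i) (lin (\<alpha> i) * divdiff D i p x)"
    by (simp only: act_mult act_s_lin) simp
  then show "lin (\<alpha> i) * divdiff D i p (s_coset i x) = lin (\<alpha> i) * act (s i) (divdiff D i p x)"
    by (simp add: lin_mult_divdiff[OF assms] s_coset_s_coset act_diff act_s_s)
qed

lemma divdiff_HT:
  assumes p: "p \<in> HT D" shows "divdiff D i p \<in> HT D"
proof -
  let ?d = "divdiff D i p"
  have "?d x = 0" if "x \<notin> cosets D" for x
  proof (rule lin_mult_eq_0[OF simple_nonzero])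
    show "lin (\<alpha> i) * ?d x = 0"
      using that HT_zero[OF p] s_coset_in_cosets_iff by (simp add: lin_mult_divdiff[OF p])
  qed
  moreover have "lin \<beta> dvd ?d (coset D (refl D \<beta> \<circ> w)) - ?d (coset D w)"
    if w: "w \<in> W" and \<beta>: "\<beta> \<in> pos" for w \<beta>
  proof (cases "\<beta> = \<alpha> i")
    case True
    have "?d (coset D (s i \<circ> w)) - ?d (coset D w) = - (?d (coset D w) - act (s i) (?d (coset D w)))"
      by (simp add: divdiff_s_coset[OF p] s_coset_coset[symmetric])
    then show ?thesis using lin_dvd_act_refl_diff[of "\<alpha> i"] True by (simp only: dvd_minus_iff)
  next
    case False
    \<comment> \<open>the action of \<open>s\<^sub>i\<close> carries the edges labelled \<open>\<gamma>\<close> to those labelled \<open>\<beta>\<close>\<close>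
    let ?\<gamma> = "s i \<beta>" and ?x = "coset D w" and ?y = "coset D (refl D \<beta> \<circ> w)"
    have root: "\<beta> \<in> \<Phi>" using \<beta> pos_root by blast
    have "refl D ?\<gamma> \<circ> (s i \<circ> w) = s i \<circ> (refl D \<beta> \<circ> w)"
      using refl_weyl_image[OF s_weyl root] by (metis comp_assoc)
    then have sy: "coset D (refl D ?\<gamma> \<circ> (s i \<circ> w)) = s_coset i ?y" by (simp add: s_coset_coset)
    have "lin ?\<gamma> dvd p (coset D (refl D ?\<gamma> \<circ> (s i \<circ> w))) - p (coset D (s i \<circ> w))"
      by (intro HT_edge_root[OF p] weyl_comp s_weyl w refl_root simple_root root)
    then have "lin ?\<gamma> dvd p (s_coset i ?y) - p (s_coset i ?x)" by (simp only: sy s_coset_coset[of i w])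
    then obtain g where "p (s_coset i ?y) - p (s_coset i ?x) = lin ?\<gamma> * g" by blast
    then have "act (s i) (p (s_coset i ?y)) - act (s i) (p (s_coset i ?x)) = lin \<beta> * act (s i) g"
      by (metis act_diff act_lin act_mult clinear_refl s_s)
    then have "lin \<beta> dvd act (s i) (p (s_coset i ?y)) - act (s i) (p (s_coset i ?x))" by (rule dvdI)
    from dvd_diff[OF HT_edge[OF p w \<beta>] this]
    have "lin \<beta> dvd (p ?y - p ?x) - (act (s i) (p (s_coset i ?y)) - act (s i) (p (s_coset i ?x)))" .
    moreover have "lin (\<alpha> i) * (?d ?y - ?d ?x)
        = (p ?y - p ?x) - (act (s i) (p (s_coset i ?y)) - act (s i) (p (s_coset i ?x)))"
      unfolding right_diff_distrib lin_mult_divdiff[OF p] by simp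
    ultimately have "lin \<beta> dvd lin (\<alpha> i) * (?d ?y - ?d ?x)" by (simp only:)
    then show ?thesis
    proof (rule lin_dvd_cancel)
      show "\<beta> \<noteq> 0" using \<beta> by (rule pos_not_zero)
      show "\<alpha> i \<noteq> c *s \<beta>" for c
        using False pos_not_proportional[OF \<beta> simple_pos] by metis
    qed
  qed
  ultimately show ?thesis by (simp add: HT_def)
qed

lemma divdiff_divdiff:
  assumes "p \<in> HT D" shows "divdiff D i (divdiff D i p) = (\<lambda>x. 0)"
  by (rule divdiff_eqI) (simp add: divdiff_s_coset[OF assms] act_s_s)

lemma divdiff_add:
  assumes "p \<in> HT D" "q \<in> HT D"
  shows "divdiff D i (\<lambda>x. p x + q x) = (\<lambda>x. divdiff D i p x + divdiff D i q x)"
  by (rule divdiff_eqI) (simp add: distrib_left lin_mult_divdiff assms act_add)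

lemma lin_mult_BGG: "lin (\<alpha> i) * BGG D i c = c - act (s i) c"
  unfolding BGG_def by (rule lin_mult_exact_quot[OF simple_nonzero lin_dvd_act_refl_diff])

lemma divdiff_leibniz:
  assumes "p \<in> HT D"
  shows "divdiff D i (\<lambda>x. c * p x) = (\<lambda>x. BGG D i c * p x + act (s i) c * divdiff D i p x)"
proof (rule divdiff_eqI)
  fix x
  have "lin (\<alpha> i) * (BGG D i c * p x + act (s i) c * divdiff D i p x)
      = (lin (\<alpha> i) * BGG D i c) * p x + act (s i) c * (lin (\<alpha> i) * divdiff D i p x)"
    by (simp add: algebra_simps)
  also have "\<dots> = (c - act (s i) c) * p x + act (s i) c * (p x - act (s i) (p (s_coset i x)))"
    by (simp only: lin_mult_BGG lin_mult_divdiff[OF assms])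
  also have "\<dots> = c * p x - act (s i) (c * p (s_coset i x))"
    by (simp add: act_mult algebra_simps)
  finally show "lin (\<alpha> i) * (BGG D i c * p x + act (s i) c * divdiff D i p x)
      = c * p x - act (s i) (c * p (s_coset i x))" .
qed

lemma divdiff_scal:
  assumes "p \<in> HT D"
  shows "divdiff D i (\<lambda>x. scal a * p x) = (\<lambda>x. scal a * divdiff D i p x)"
  by (rule divdiff_eqI)
    (simp add: mult.left_commute lin_mult_divdiff[OF assms] act_mult act_scal right_diff_distrib)

section \<open>Flow-up classes\<close>

abbreviation out_product where "out_product x \<equiv> (\<Prod>\<beta>\<in>out_labels x. lin \<beta>)"

lemma out_labels_pos: "\<beta> \<in> out_labels x \<Longrightarrow> \<beta> \<in> pos"
  by (simp add: inversions_def)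

lemma zero_not_out_label: "0 \<notin> out_labels x"
  using out_labels_pos pos_not_zero by blast

lemma out_product_nonzero: "out_product x \<noteq> 0"
  using prod_lin_mult_eq_0[OF finite_inversions zero_not_out_label, of x 1] by auto

text \<open>
  Across each edge out of \<open>x\<close> the value \<open>f(x)\<close> is compared with zero, so it is divisible by every label;
  distinct positive roots are not proportional, so it is divisible by their product.
\<close>
lemma out_product_dvd:
  assumes f: "f \<in> HT D" and x: "x \<in> cosets D"
    and below: "\<And>y. y \<in> cosets D \<Longrightarrow> coset_len y < coset_len x \<Longrightarrow> f y = 0"
  shows "out_product x dvd f x"
proof (rule prod_lin_dvd[OF finite_inversions zero_not_out_label])
  show "\<gamma> = \<beta>" if "\<beta> \<in> out_labels x" "\<gamma> \<in> out_labels x" "\<gamma> = c *s \<beta>" for \<beta> \<gamma> c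
    using that out_labels_pos pos_not_proportional by blast
  fix \<beta> assume \<beta>: "\<beta> \<in> out_labels x"
  let ?y = "coset D (refl D \<beta> \<circ> min_rep D x)"
  have "f ?y = 0" using out_edge_shorter[OF x \<beta>] below by blast
  moreover have "lin \<beta> dvd f ?y - f (coset D (min_rep D x))"
    using f \<beta> x min_rep_weyl out_labels_pos by (intro HT_edge)
  ultimately show "lin \<beta> dvd f x" by (simp add: coset_min_rep[OF x])
qed

text \<open>
  The degree is imposed on \<open>\<alpha>\<^sub>i f\<close> instead of \<open>f\<close>: for \<open>f = \<delta>\<^sub>i p\<close> the product is the numerator, whose
  degree is that of \<open>p\<close>.  This is the source of the additional one in the conclusion, and it avoids the
  degree \<open>\<ell>([v]) - 1\<close>, which makes no sense as a natural number at the base point.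
\<close>
lemma lowest_support_length:
  assumes f: "f \<in> HT D" and "f \<noteq> (\<lambda>x. 0)"
    and hom: "\<And>x. x \<in> cosets D \<Longrightarrow> homogeneous d (lin (\<alpha> i) * f x)"
  obtains x where "x \<in> cosets D" "f x \<noteq> 0" "Suc (coset_len x) \<le> d"
proof -
  obtain x0 where "f x0 \<noteq> 0" using assms(2) by blast
  then have "x0 \<in> cosets D \<and> f x0 \<noteq> 0" using HT_zero[OF f] by blast
  then obtain x where x: "x \<in> cosets D" "f x \<noteq> 0"
    and least: "\<And>y. y \<in> cosets D \<and> f y \<noteq> 0 \<Longrightarrow> coset_len x \<le> coset_len y"
    using ex_has_least_nat[of "\<lambda>x. x \<in> cosets D \<and> f x \<noteq> 0" x0 coset_len] by blast
  have "out_product x dvd f x"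
    using least by (intro out_product_dvd[OF f x(1)]) (meson not_less)
  then have "lin (\<alpha> i) * out_product x dvd lin (\<alpha> i) * f x" by (rule mult_dvd_mono[OF dvd_refl])
  moreover have "homogeneous (1 + coset_len x) (lin (\<alpha> i) * out_product x)"
    using homogeneous_mult[OF homogeneous_lin homogeneous_prod_lin] card_out_labels[OF x(1)] by metis
  moreover have "lin (\<alpha> i) * f x \<noteq> 0" using x(2) lin_mult_eq_0 simple_nonzero by blast
  ultimately have "1 + coset_len x \<le> d" using hom[OF x(1)] homogeneous_multiple_degree by blast
  then show ?thesis using that x by simp
qed

text \<open>
  The common degree of the values is not prescribed by the definition; it is read off from the
  nonzero value at \<open>x\<close>.
\<close>
lemma flow_up:
  assumes "is_flow_up D x p" "x \<in> cosets D"
  shows flow_up_HT: "p \<in> HT D"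
    and flow_up_support: "y \<in> cosets D \<Longrightarrow> p y \<noteq> 0 \<longleftrightarrow> le_P D x y"
    and flow_up_value: "p x = out_product x"
    and flow_up_homogeneous: "homogeneous (coset_len x) (p y)"
proof -
  show HT: "p \<in> HT D" and "y \<in> cosets D \<Longrightarrow> p y \<noteq> 0 \<longleftrightarrow> le_P D x y" and val: "p x = out_product x"
    using assms prod_out_edges by (auto simp: is_flow_up_def)
  obtain d where d: "\<And>y. y \<in> cosets D \<Longrightarrow> homogeneous d (p y)"
    using assms by (auto simp: is_flow_up_def)
  have "homogeneous (coset_len x) (p x)"
    using homogeneous_prod_lin[of "out_labels x"] by (simp add: val card_out_labels assms(2))
  then have "d = coset_len x"
    using d[OF assms(2)] homogeneous_unique out_product_nonzero val by metis
  then show "homogeneous (coset_len x) (p y)"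
    using d HT_zero[OF HT] by (cases "y \<in> cosets D") auto
qed

lemma flow_up_support_len:
  assumes "is_flow_up D x p" "x \<in> cosets D" "y \<in> cosets D" "p y \<noteq> 0"
  shows "y = x \<or> coset_len x < coset_len y"
  using assms flow_up_support le_P_len by blast

lemma homogeneous_divdiff_flow_up:
  assumes "is_flow_up D x p" "x \<in> cosets D"
  shows "homogeneous (coset_len x) (lin (\<alpha> i) * divdiff D i p y)"
  unfolding lin_mult_divdiff[OF flow_up_HT[OF assms]]
  by (intro homogeneous_diff homogeneous_act flow_up_homogeneous[OF assms])

lemma coset_len_s_coset_le:
  assumes "x \<in> cosets D" shows "coset_len (s_coset i x) \<le> Suc (coset_len x)"
proof -
  let ?w = "min_rep D x"
  have s_x: "s_coset i x = coset D (s i \<circ> ?w)" using coset_min_rep[OF assms] s_coset_coset by metis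
  then have "s i \<circ> ?w \<in> s_coset i x" by (simp add: coset_self)
  then have "coset_len (s_coset i x) \<le> len D (s i \<circ> ?w)"
    using assms s_coset_in_cosets_iff min_rep_le by blast
  also have "\<dots> \<le> Suc (len D ?w)" using assms min_rep_weyl by (intro len_s_le)
  finally show ?thesis .
qed

text \<open>
  At a coset shorter than \<open>x\<close> the class \<open>p\<close> vanishes, so the numerator can be nonzero only through
  \<open>p(s\<^sub>i y)\<close>.  Since \<open>s\<^sub>i y\<close> is at most one longer than \<open>y\<close>, the support of \<open>p\<close> leaves only \<open>s\<^sub>i y = x\<close>.
\<close>
lemma divdiff_flow_up_support:
  assumes p: "is_flow_up D x p" and x: "x \<in> cosets D" and y: "y \<in> cosets D"
    and "divdiff D i p y \<noteq> 0" "Suc (coset_len y) \<le> coset_len x"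
  shows "y = s_coset i x"
proof -
  have "p y = 0" using flow_up_support_len[OF p x y] assms(5) by fastforce
  moreover have "lin (\<alpha> i) * divdiff D i p y \<noteq> 0" using assms(4) lin_mult_eq_0 simple_nonzero by blast
  ultimately have "p (s_coset i y) \<noteq> 0" by (auto simp: lin_mult_divdiff[OF flow_up_HT[OF p x]])
  then have "s_coset i y = x \<or> coset_len x < coset_len (s_coset i y)"
    using flow_up_support_len[OF p x] y s_coset_in_cosets_iff by blast
  then have "s_coset i y = x" using coset_len_s_coset_le[OF y, of i] assms(5) by auto
  then show ?thesis using s_coset_s_coset by metis
qed

text \<open>
  The sign cancels the one in \<open>p(s\<^sub>i x) - s\<^sub>i p(x)\<close>, the numerator at \<open>s\<^sub>i x\<close> of the divided difference of the
  flow-up class of \<open>x\<close>, because \<open>p(s\<^sub>i x) = 0\<close>.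
\<close>
lemma out_product_s_coset:
  assumes x: "x \<in> cosets D" and shorter: "coset_len (s_coset i x) < coset_len x"
  shows "act (s i) (out_product x) = - (lin (\<alpha> i) * out_product (s_coset i x))"
proof -
  let ?w = "min_rep D x" let ?v = "s i \<circ> ?w"
  have s_x: "s_coset i x = coset D ?v" using coset_min_rep[OF x] s_coset_coset by metis
  have rep: "min_rep D (s_coset i x) = ?v" using min_rep_s_shorter[OF x] shorter by (simp add: s_x)
  have v: "?v \<in> W" using x min_rep_weyl weyl_comp s_weyl by blast
  have w: "?w = s i \<circ> ?v" by (simp only: s_s_comp)
  have "\<alpha> i \<notin> inversions ?v"
  proof
    assume "\<alpha> i \<in> inversions ?v"
    from len_refl_comp_less[OF v this] have "len D ?w < len D ?v" by (simp only: s_s_comp)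
    then show False using shorter rep by simp
  qed
  note inv = inversions_s[OF v this]
  have "out_product x = lin (\<alpha> i) * (\<Prod>\<beta>\<in>inversions ?v. lin (s i \<beta>))"
    by (subst w) (simp only: inv prod.insert[OF finite_imageI[OF finite_inversions] inv(2)]
        prod.reindex[OF inj_s, unfolded comp_def])
  then show ?thesis by (simp add: act_mult act_s_lin act_prod act_lin clinear_refl s_s rep)
qed

lemma divdiff_flow_up_not_shorter:
  assumes p: "is_flow_up D x p" and x: "x \<in> cosets D" and "\<not> coset_len (s_coset i x) < coset_len x"
  shows "divdiff D i p = (\<lambda>x. 0)"
proof (rule ccontr)
  assume "divdiff D i p \<noteq> (\<lambda>x. 0)"
  then obtain y where y: "y \<in> cosets D" "divdiff D i p y \<noteq> 0" "Suc (coset_len y) \<le> coset_len x"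
    using lowest_support_length[OF divdiff_HT[OF flow_up_HT[OF p x]]] homogeneous_divdiff_flow_up[OF p x]
    by metis
  from divdiff_flow_up_support[OF p x this] y(3) assms(3) show False by simp
qed

lemma HT_diff:
  assumes "p \<in> HT D" "q \<in> HT D" shows "(\<lambda>x. p x - q x) \<in> HT D"
proof -
  have "lin \<beta> dvd p y - q y - (p x - q x)" if "lin \<beta> dvd p y - p x" "lin \<beta> dvd q y - q x" for \<beta> x y
  proof -
    have "p y - q y - (p x - q x) = (p y - p x) - (q y - q x)" by simp
    then show ?thesis using dvd_diff[OF that] by metis
  qed
  with assms show ?thesis by (auto simp: HT_def)
qed

text \<open>
  The two classes agree at \<open>s\<^sub>i x\<close>, which is the only coset shorter than \<open>x\<close> where either of them can be nonzero.
  By the degree bound their difference, if nonzero, would have to be nonzero at some coset shorter than \<open>x\<close>.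
\<close>
lemma divdiff_flow_up_shorter:
  assumes p: "is_flow_up D x p" and x: "x \<in> cosets D" and shorter: "coset_len (s_coset i x) < coset_len x"
    and q: "is_flow_up D (s_coset i x) q"
  shows "divdiff D i p = q"
proof -
  have s_x: "s_coset i x \<in> cosets D" using x s_coset_in_cosets_iff by blast
  have HT: "p \<in> HT D" "q \<in> HT D" using flow_up_HT p q x s_x by blast+
  have len: "coset_len x = Suc (coset_len (s_coset i x))"
    using shorter coset_len_s_coset_le[OF s_x, of i] by (simp add: s_coset_s_coset)
  let ?f = "\<lambda>y. divdiff D i p y - q y"
  have zero: "?f (s_coset i x) = 0"
  proof (rule lin_mult_eq_0[OF simple_nonzero])
    have "p (s_coset i x) = 0" using flow_up_support_len[OF p x s_x] shorter by fastforce
    then have "lin (\<alpha> i) * divdiff D i p (s_coset i x) = lin (\<alpha> i) * q (s_coset i x)"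
      by (simp add: lin_mult_divdiff[OF HT(1)] s_coset_s_coset flow_up_value[OF p x] flow_up_value[OF q s_x]
          out_product_s_coset[OF x shorter])
    then show "lin (\<alpha> i) * ?f (s_coset i x) = 0" by (simp add: right_diff_distrib)
  qed
  have "?f = (\<lambda>x. 0)"
  proof (rule ccontr)
    assume nonzero: "?f \<noteq> (\<lambda>x. 0)"
    have "homogeneous (coset_len x) (lin (\<alpha> i) * q y)" for y
      using homogeneous_mult[OF homogeneous_lin flow_up_homogeneous[OF q s_x]] by (simp add: len)
    then have "homogeneous (coset_len x) (lin (\<alpha> i) * ?f y)" for y
      unfolding right_diff_distrib by (intro homogeneous_diff homogeneous_divdiff_flow_up[OF p x])
    then obtain y where y: "y \<in> cosets D" "?f y \<noteq> 0" "Suc (coset_len y) \<le> coset_len x"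
      using lowest_support_length[OF HT_diff[OF divdiff_HT[OF HT(1)] HT(2)] nonzero] by metis
    have "y \<noteq> s_coset i x" using y(2) zero by metis
    moreover from this have "q y = 0"
      using flow_up_support_len[OF q s_x y(1)] y(3) len by fastforce
    ultimately show False using divdiff_flow_up_support[OF p x y(1) _ y(3)] y(2) by auto
  qed
  then show ?thesis by (simp add: fun_eq_iff)
qed

lemma less_P_s_coset_iff: "x \<in> cosets D \<Longrightarrow> less_P D (s_coset i x) x \<longleftrightarrow> coset_len (s_coset i x) < coset_len x"
  using less_P_s_iff[of x i] s_coset_coset[of i "min_rep D x"] by (simp add: coset_min_rep)

end

theorem proposition5p2:
  fixes D :: "('n::finite) flag_datum" and i :: 'n
  assumes "flag_datum D"
  shows
    "(\<forall>p\<in>HT D. (\<forall>x. lin (simple D i) dvd p x - weyl_act (simple_refl D i) p x) \<and>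
        divdiff D i p \<in> HT D) \<and>
     (\<forall>p\<in>HT D. \<forall>q\<in>HT D.
        divdiff D i (\<lambda>x. p x + q x) = (\<lambda>x. divdiff D i p x + divdiff D i q x)) \<and>
     (\<forall>a. \<forall>p\<in>HT D. divdiff D i (\<lambda>x. scal a * p x) = (\<lambda>x. scal a * divdiff D i p x)) \<and>
     (\<forall>p\<in>HT D. divdiff D i (divdiff D i p) = (\<lambda>x. 0)) \<and>
     (\<forall>fl :: 'n coset \<Rightarrow> 'n coh.
        (\<forall>v\<in>weyl D. is_flow_up D (coset D v) (fl (coset D v))) \<longrightarrow>
        (\<forall>v\<in>weyl D.
          (\<forall>c. divdiff D i (\<lambda>x. c * fl (coset D v) x) =
            (\<lambda>x. BGG D i c * fl (coset D v) x
                 + act (simple_refl D i) c * divdiff D i (fl (coset D v)) x)) \<and>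
          divdiff D i (fl (coset D v)) =
            (if less_P D (coset D (simple_refl D i \<circ> v)) (coset D v)
             then fl (coset D (simple_refl D i \<circ> v)) else (\<lambda>x. 0))))"
proof -
  interpret root_datum D by unfold_locales (rule assms)
  have basis: "divdiff D i (fl (coset D v)) =
      (if less_P D (coset D (simple_refl D i \<circ> v)) (coset D v)
       then fl (coset D (simple_refl D i \<circ> v)) else (\<lambda>x. 0))"
    if fl: "\<forall>v\<in>weyl D. is_flow_up D (coset D v) (fl (coset D v))" and v: "v \<in> weyl D"
    for fl :: "'n coset \<Rightarrow> 'n coh" and v
  proof -
    have x: "coset D v \<in> cosets D" using v by (rule coset_in_cosets)
    have p: "is_flow_up D (coset D v) (fl (coset D v))"
      and q: "is_flow_up D (s_coset i (coset D v)) (fl (s_coset i (coset D v)))"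
      using fl v weyl_comp[OF s_weyl v] by (simp_all add: s_coset_coset)
    show ?thesis
      unfolding s_coset_coset[symmetric] less_P_s_coset_iff[OF x]
      using divdiff_flow_up_shorter[OF p x _ q] divdiff_flow_up_not_shorter[OF p x] by simp
  qed
  have leibniz: "divdiff D i (\<lambda>x. c * fl (coset D v) x) =
      (\<lambda>x. BGG D i c * fl (coset D v) x
         + act (simple_refl D i) c * divdiff D i (fl (coset D v)) x)"
    if "\<forall>v\<in>weyl D. is_flow_up D (coset D v) (fl (coset D v))" "v \<in> weyl D"
    for fl :: "'n coset \<Rightarrow> 'n coh" and v c
    using that flow_up_HT coset_in_cosets by (intro divdiff_leibniz) blast
  show ?thesis
    using lin_dvd_divdiff_numerator divdiff_HT divdiff_add divdiff_scal divdiff_divdiff leibniz basis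
    by (intro conjI ballI allI impI) blast+
qed

end
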